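(* Let $1<p<\infty$, let $(u,v)$ be a pair of weights on $\mathbb{R}^n$ with $(u,v)\in A_p$, and suppose $u\in A_\infty$. Then for every Lipschitz function $f$ and every cube $Q$ $$\left(\frac{1}{u(Q)}\int_Q|f-f_Q|^p\,u\,dx\right)^{1/p}\le c_n\,[u,v]_{A_p}^{1/p}\,\ell(Q)\left(\frac{1}{u(Q)}\int_Q|\nabla f|^p\,v\,dx\right)^{1/p},$$ where $c_n$ is a constant depending only on the dimension $n$.
   Context: Cubes are cubes in $\mathbb{R}^n$ with sides parallel to the coordinate axes, with side length $\ell(Q)$. A weight is a locally integrable non-negative function; $u(Q)=\int_Q u\,dx$; $f_Q=\frac{1}{|Q|}\int_Q f\,dx$. $A_\infty=\bigcup_{q\ge1}A_q$ is the union of the one-weight Muckenhoupt classes. A pair of weights $(u,v)$ belongs to $A_p$ if $$[u,v]_{A_p}:=\sup_Q\left(\frac{1}{|Q|}\int_Q u\,dx\right)\left(\frac{1}{|Q|}\int_Q v^{1-p'}\,dx\right)^{p-1}<\infty,$$ the supremum being over all cubes, with $p'=p/(p-1)$. *)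

theory Defs
  imports "HOL-Analysis.Analysis"
begin

text \<open>Real powers on \<open>[0,\<infinity>]\<close>. Unlike \<open>powr\<close> on the reals, a negative power of \<open>0\<close> is \<open>\<infinity>\<close>;
  this matters for \<open>v\<close> raised to \<open>1 - p'\<close> at zeros of \<open>v\<close>.\<close>

definition ennpowr :: "ennreal \<Rightarrow> real \<Rightarrow> ennreal" where
  "ennpowr x a =
     (if a = 0 then 1
      else if x = 0 then (if a < 0 then top else 0)
      else if x = top then (if a < 0 then 0 else top)
      else ennreal (enn2real x powr a))"

definition conj_exp :: "real \<Rightarrow> real" where
  "conj_exp p = p / (p - 1)"

definition cube :: "real^'n \<Rightarrow> real \<Rightarrow> (real^'n) set" where
  "cube a l = cbox a (\<chi> i. a $ i + l)"

definition cubes :: "(real^'n) set set" where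
  "cubes = {cube a l | a l. 0 < l}"

definition weight :: "(real^'n \<Rightarrow> real) \<Rightarrow> bool" where
  "weight u \<longleftrightarrow> (\<forall>x. 0 \<le> u x) \<and> (\<forall>K. compact K \<longrightarrow> set_integrable lebesgue K u)"

definition wmass :: "(real^'n \<Rightarrow> real) \<Rightarrow> (real^'n) set \<Rightarrow> ennreal" where
  "wmass u Q = (\<integral>\<^sup>+x\<in>Q. ennreal (u x) \<partial>lebesgue)"

definition nn_avg :: "(real^'n) set \<Rightarrow> (real^'n \<Rightarrow> ennreal) \<Rightarrow> ennreal" where
  "nn_avg Q g = 1 / emeasure lebesgue Q * (\<integral>\<^sup>+x\<in>Q. g x \<partial>lebesgue)"

definition avg :: "(real^'n) set \<Rightarrow> (real^'n \<Rightarrow> real) \<Rightarrow> real" where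
  "avg Q f = 1 / measure lebesgue Q * (LINT x:Q|lebesgue. f x)"

definition Ap_const :: "real \<Rightarrow> (real^'n \<Rightarrow> real) \<Rightarrow> (real^'n \<Rightarrow> real) \<Rightarrow> ennreal" where
  "Ap_const p u v =
     (SUP Q\<in>cubes. nn_avg Q (\<lambda>x. ennreal (u x)) *
        ennpowr (nn_avg Q (\<lambda>x. ennpowr (ennreal (v x)) (1 - conj_exp p))) (p - 1))"

definition Ap_pair :: "real \<Rightarrow> (real^'n \<Rightarrow> real) \<Rightarrow> (real^'n \<Rightarrow> real) \<Rightarrow> bool" where
  "Ap_pair p u v \<longleftrightarrow> weight u \<and> weight v \<and> Ap_const p u v < top"

definition A1_weight :: "(real^'n \<Rightarrow> real) \<Rightarrow> bool" where
  "A1_weight u \<longleftrightarrow> weight u \<and>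
     (\<exists>C::real. \<forall>Q\<in>cubes. AE x in lebesgue. x \<in> Q \<longrightarrow>
        nn_avg Q (\<lambda>y. ennreal (u y)) \<le> ennreal C * ennreal (u x))"

definition Aq_weight :: "real \<Rightarrow> (real^'n \<Rightarrow> real) \<Rightarrow> bool" where
  "Aq_weight q u \<longleftrightarrow> (if q = 1 then A1_weight u else Ap_pair q u u)"

definition Ainf_weight :: "(real^'n \<Rightarrow> real) \<Rightarrow> bool" where
  "Ainf_weight u \<longleftrightarrow> (\<exists>q\<ge>1. Aq_weight q u)"

text \<open>The gradient as the vector of partial derivatives. For Lipschitz \<open>f\<close> these exist almost
  everywhere; on the remaining null set \<open>deriv\<close> is unspecified, which no integral sees.\<close>

definition grad :: "(real^'n \<Rightarrow> real) \<Rightarrow> real^'n \<Rightarrow> real^'n" where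
  "grad f x = (\<chi> i. deriv (\<lambda>t. f (x + axis i t)) 0)"

end

theory Submission
  imports Defs
begin

text \<open>
  Bisect a box across its longest side. On each half, the mean of \<open>f\<close> differs from the mean on
  the whole box by at most the size of the box times the mean of \<open>\<bar>\<nabla>f\<bar>\<close>, because the halves are
  translates of each other along one axis. Boxes arising this way from a cube have sides
  comparable up to a factor \<open>2\<close>, so that the Hoelder inequality and the two-weight condition bound
  the \<open>L\<^sup>p(u)\<close> norm of this jump by \<open>2\<^sup>n [u,v]\<^sup>1\<^sup>/\<^sup>p\<close> times the \<open>L\<^sup>p(v)\<close> norm of \<open>\<nabla>f\<close>. The size of the
  box, \<open>\<bar>B\<bar>\<^sup>1\<^sup>/\<^sup>n\<close>, shrinks by the factor \<open>\<theta> = 2 powr (-1/n)\<close> at each bisection, hence the jumps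
  sum to a geometric series and the constant is \<open>2\<^sup>n / (1 - \<theta>)\<close>.
\<close>

section \<open>Lipschitz functions on the line\<close>

text \<open>The constant must not depend on \<open>p\<close>, so the jumps are not summed point by
  point along the chain of boxes around \<open>x\<close>. Everything is carried instead by the
  \<open>u\<close>-mass and the energy, both additive over the two halves: a jump is weighted with
  the \<open>u\<close>-mass of the box on which it occurs, and the energies of all boxes of one
  generation add up to that of the cube. The chain is cut after finitely many bisections. What is
  left is the oscillation on small boxes, at most a multiple of the Lipschitz constant times their
  size; it vanishes in the limit against the finite mass \<open>u(Q)\<close>, so the Lipschitz
  constant leaves no trace in the result. A separate obstacle is the gradient: it is meaningful only
  almost everywhere, while the jump estimate integrates it along lines, which are null sets once the
  dimension exceeds one. Hence a Borel representative is built that controls the increments of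
  \<open>f\<close> on every line.\<close>

text \<open>
  Adding a linear term makes \<open>\<phi>\<close> a bi-Lipschitz homeomorphism \<open>F\<close> with increments at least those
  of the identity. The push-forward of Lebesgue measure under its inverse is absolutely continuous, since \<open>F\<close>
  preserves null sets, so its Radon-Nikodym density is the derivative of \<open>F\<close>.
\<close>

lemma lipschitz_has_integral_density:
  fixes \<phi> :: "real \<Rightarrow> real"
  assumes lip: "L-lipschitz_on UNIV \<phi>"
  obtains g where "g \<in> borel_measurable borel"
    "\<And>a b. a \<le> b \<Longrightarrow> (g has_integral (\<phi> b - \<phi> a)) {a..b}"
proof -
  have L: "\<bar>\<phi> x - \<phi> y\<bar> \<le> L * \<bar>x - y\<bar>" for x y
    using lipschitz_onD[OF lip, of x y] by (simp add: dist_real_def)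
  have L0: "0 \<le> L" using lip by (rule lipschitz_on_nonneg)
  define F where "F x = \<phi> x + (L + 1) * x" for x
  have F_incr: "y - x \<le> F y - F x" if "x \<le> y" for x y
    using L[of y x] that by (simp add: F_def algebra_simps abs_if split: if_splits)
  have F_mono: "F x \<le> F y \<longleftrightarrow> x \<le> y" for x y
    using F_incr[of x y] F_incr[of y x] by (smt (verit))
  have F_inj: "inj F"
    by (rule injI) (metis F_mono order_antisym order_refl)
  have F_lip: "\<bar>F x - F y\<bar> \<le> (2 * L + 1) * \<bar>x - y\<bar>" for x y
  proof -
    have "\<bar>F x - F y\<bar> = \<bar>(\<phi> x - \<phi> y) + (L + 1) * (x - y)\<bar>"
      by (simp add: F_def algebra_simps)
    also have "\<dots> \<le> L * \<bar>x - y\<bar> + (L + 1) * \<bar>x - y\<bar>"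
      using L[of x y] L0 abs_triangle_ineq[of "\<phi> x - \<phi> y" "(L + 1) * (x - y)"] by (simp add: abs_mult)
    finally show ?thesis by (simp add: algebra_simps)
  qed
  have "continuous_on UNIV \<phi>" using lip by (rule lipschitz_on_continuous_on)
  then have F_cont: "continuous_on UNIV F"
    unfolding F_def by (intro continuous_intros) auto
  have F_surj: "\<exists>x. F x = y" for y
  proof -
    define r where "r = \<bar>y\<bar> + \<bar>F 0\<bar>"
    have "F (-r) \<le> y" "y \<le> F r" "-r \<le> r"
      using F_incr[of "-r" 0] F_incr[of 0 r] unfolding r_def by linarith+
    then show ?thesis
      using IVT'[of F "-r" y r] continuous_on_subset[OF F_cont] by blast
  qed
  define G where "G = inv F"
  have FG: "F (G y) = y" for y
    unfolding G_def using F_surj by (metis f_inv_into_f rangeI)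
  have GF: "G (F x) = x" for x
    unfolding G_def using F_inj by simp
  have "mono G"
    by (rule monoI) (metis F_mono FG)
  then have G_meas [measurable]: "G \<in> borel_measurable borel"
    by (rule borel_measurable_mono)
  \<comment> \<open>The preimage of \<open>{a..b}\<close> under \<open>G\<close> is
    \<open>{F a..F b}\<close>, so \<open>M\<close> assigns to an interval the increment of
    \<open>F\<close> over it.\<close>
  define M where "M = distr lborel borel G"
  have emM: "emeasure M A = emeasure lborel (G -` A)" if "A \<in> sets borel" for A
    unfolding M_def using that by (subst emeasure_distr) auto
  have M_Icc: "emeasure M {a..b} = ennreal (F b - F a)" if "a \<le> b" for a b
  proof -
    have "G -` {a..b} = {F a..F b}"
      by (auto simp: FG F_mono) (metis F_mono FG)+
    then show ?thesis
      using F_mono that by (simp add: emM)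
  qed
  have ac: "absolutely_continuous lborel M"
    unfolding absolutely_continuous_def
  proof
    fix A :: "real set" assume A: "A \<in> null_sets lborel"
    then have Ab: "A \<in> sets borel" by auto
    have "negligible A"
      using A by (simp add: negligible_iff_null_sets null_sets_completionI)
    then have "negligible (F ` A)"
    proof (rule negligible_locally_Lipschitz_image[rotated])
      fix x assume "x \<in> A"
      show "\<exists>T B. open T \<and> x \<in> T \<and> (\<forall>y\<in>A \<inter> T. norm (F y - F x) \<le> B * norm (y - x))"
        by (intro exI[of _ UNIV] exI[of _ "2 * L + 1"]) (use F_lip in auto)
    qed auto
    moreover have "F ` A = G -` A"
      by (force simp: GF FG image_iff)
    moreover have "G -` A \<in> sets lborel"
      using measurable_sets[OF G_meas Ab] by simp
    ultimately have "emeasure lborel (G -` A) = 0"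
      by (simp add: negligible_iff_emeasure0)
    then show "A \<in> null_sets M"
      using Ab by (auto simp: null_sets_def emM) (simp add: M_def)
  qed
  have "sets M = sets lborel" by (simp add: M_def)
  then obtain h where h [measurable]: "h \<in> borel_measurable borel" and dens: "density lborel h = M"
    using sigma_finite_measure.Radon_Nikodym[OF lborel.sigma_finite_measure_axioms ac] by auto
  have h_Icc: "(\<integral>\<^sup>+x\<in>{a..b}. h x \<partial>lborel) = ennreal (F b - F a)" if "a \<le> b" for a b
    using M_Icc[OF that] by (simp add: dens[symmetric] emeasure_density)
  \<comment> \<open>Bounded intervals have finite \<open>M\<close>-mass, so \<open>h\<close> is
    finite almost everywhere and passing to \<open>enn2real\<close> changes no integral.\<close>
  have h_fin_Icc: "AE x in lborel. x \<in> {-real n..real n} \<longrightarrow> h x \<noteq> \<infinity>" for n :: nat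
  proof -
    have "AE x in lborel. h x * indicator {-real n..real n} x \<noteq> \<infinity>"
      by (rule nn_integral_PInf_AE) (auto simp: h_Icc)
    then show ?thesis by eventually_elim (auto simp: indicator_def split: if_splits)
  qed
  have h_fin: "AE x in lborel. h x \<noteq> \<infinity>"
  proof -
    have "AE x in lborel. \<forall>n::nat. x \<in> {-real n..real n} \<longrightarrow> h x \<noteq> \<infinity>"
      unfolding AE_all_countable using h_fin_Icc by blast
    then show ?thesis
    proof eventually_elim
      case (elim x)
      obtain n :: nat where "\<bar>x\<bar> \<le> real n" using real_arch_simple by blast
      then have "x \<in> {-real n..real n}" by auto
      then show ?case using elim by blast
    qed
  qed
  define g where "g x = enn2real (h x) - (L + 1)" for x
  have int_h: "((\<lambda>x. enn2real (h x)) has_integral (F b - F a)) {a..b}" if "a \<le> b" for a b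
  proof -
    have "(\<integral>\<^sup>+x. ennreal (indicator {a..b} x *\<^sub>R enn2real (h x)) \<partial>lborel) = (\<integral>\<^sup>+x\<in>{a..b}. h x \<partial>lborel)"
      using h_fin by (intro nn_integral_cong_AE) (auto elim!: eventually_mono simp: indicator_def less_top)
    also have "\<dots> = ennreal (F b - F a)" by (rule h_Icc[OF that])
    finally have "((\<lambda>x. indicator {a..b} x *\<^sub>R enn2real (h x)) has_integral (F b - F a)) UNIV"
      using F_mono that by (intro nn_integral_has_integral) auto
    moreover have "(\<lambda>x. indicator {a..b} x *\<^sub>R enn2real (h x)) =
        (\<lambda>x. if x \<in> {a..b} then enn2real (h x) else 0)"
      by (auto simp: fun_eq_iff)
    ultimately show ?thesis
      by (simp only: has_integral_restrict_UNIV)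
  qed
  have "g \<in> borel_measurable borel" unfolding g_def by measurable
  moreover have "(g has_integral (\<phi> b - \<phi> a)) {a..b}" if "a \<le> b" for a b
  proof -
    have "((\<lambda>x. L + 1) has_integral (L + 1) * (b - a)) {a..b}"
      using has_integral_const_real[of "L + 1" a b] that by (simp add: mult.commute)
    from has_integral_diff[OF int_h[OF that] this] show ?thesis
      by (simp add: g_def[abs_def] F_def algebra_simps)
  qed
  ultimately show ?thesis using that by blast
qed

text \<open>Lebesgue differentiation of the density \<open>g\<close>. The theorem used concerns
  intervals to the right of \<open>x\<close> only, hence yields right-hand quotients; the left-hand
  ones come from the reflected density.\<close>

lemma lipschitz_AE_has_derivative:
  fixes \<phi> :: "real \<Rightarrow> real"
  assumes lip: "L-lipschitz_on UNIV \<phi>"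
  obtains g where "g \<in> borel_measurable borel"
    "\<And>a b. a \<le> b \<Longrightarrow> (g has_integral (\<phi> b - \<phi> a)) {a..b}"
    "AE x in lborel. (\<phi> has_real_derivative g x) (at x)"
proof -
  obtain g where g [measurable]: "g \<in> borel_measurable borel"
    and int: "\<And>a b. a \<le> b \<Longrightarrow> (g has_integral (\<phi> b - \<phi> a)) {a..b}"
    using lipschitz_has_integral_density[OF lip] by blast
  have "g integrable_on cbox a b" for a b
    using int[of a b] by (cases "a \<le> b") (auto simp: integrable_on_def)
  then obtain N where N: "negligible N"
    "\<And>x e. x \<notin> N \<Longrightarrow> 0 < e \<Longrightarrow> \<exists>d>0. \<forall>h. 0 < h \<and> h < d \<longrightarrow>
        norm (integral (cbox x (x + h *\<^sub>R One)) g /\<^sub>R h ^ DIM(real) - g x) < e"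
    using integrable_ccontinuous_explicit[of g] by blast
  \<comment> \<open>Reflection turns intervals to the left of \<open>x\<close> into intervals to the
    right of \<open>-x\<close>; the exceptional set \<open>N'\<close> is carried back by
    \<open>uminus\<close>.\<close>
  have int': "((\<lambda>x. g (-x)) has_integral (\<phi> (-a) - \<phi> (-b))) {a..b}" if "a \<le> b" for a b
    using int[of "-b" "-a"] that has_integral_reflect_lemma_real[of g _ "-b" "-a"] by simp
  have "(\<lambda>x. g (-x)) integrable_on cbox a b" for a b
    using int'[of a b] by (cases "a \<le> b") (auto simp: integrable_on_def)
  then obtain N' where N': "negligible N'"
    "\<And>x e. x \<notin> N' \<Longrightarrow> 0 < e \<Longrightarrow> \<exists>d>0. \<forall>h. 0 < h \<and> h < d \<longrightarrow>
        norm (integral (cbox x (x + h *\<^sub>R One)) (\<lambda>x. g (-x)) /\<^sub>R h ^ DIM(real) - g (-x)) < e"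
    using integrable_ccontinuous_explicit[of "\<lambda>x. g (-x)"] by blast
  have "negligible (uminus ` N')"
    using N'(1) by (intro negligible_differentiable_image_negligible)
      (auto intro!: derivative_intros simp: differentiable_on_def)
  have der: "(\<phi> has_real_derivative g x) (at x)" if "x \<notin> N" "x \<notin> uminus ` N'" for x
  proof -
    have "-x \<notin> N'" using that(2) by force
    have "((\<lambda>h. (\<phi> (x + h) - \<phi> x) / h) \<longlongrightarrow> g x) (at 0)"
      unfolding tendsto_iff eventually_at dist_real_def
    proof (intro allI impI)
      fix e :: real assume "0 < e"
      obtain d where d: "0 < d" "\<And>h. 0 < h \<Longrightarrow> h < d \<Longrightarrow> \<bar>integral {x..x + h} g / h - g x\<bar> < e"
        using N(2)[OF \<open>x \<notin> N\<close> \<open>0 < e\<close>] by (auto simp: divide_inverse mult.commute)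
      obtain d' where d': "0 < d'"
        "\<And>h. 0 < h \<Longrightarrow> h < d' \<Longrightarrow> \<bar>integral {-x..-x + h} (\<lambda>x. g (-x)) / h - g x\<bar> < e"
        using N'(2)[OF \<open>-x \<notin> N'\<close> \<open>0 < e\<close>] by (auto simp: divide_inverse mult.commute)
      show "\<exists>d>0. \<forall>h\<in>UNIV. h \<noteq> 0 \<and> \<bar>h - 0\<bar> < d \<longrightarrow> \<bar>(\<phi> (x + h) - \<phi> x) / h - g x\<bar> < e"
      proof (intro exI[of _ "min d d'"] conjI ballI impI)
        fix h :: real assume h: "h \<noteq> 0 \<and> \<bar>h - 0\<bar> < min d d'"
        show "\<bar>(\<phi> (x + h) - \<phi> x) / h - g x\<bar> < e"
        proof (cases "0 < h")
          case True
          have "integral {x..x + h} g = \<phi> (x + h) - \<phi> x"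
            using True by (intro integral_unique int) auto
          then show ?thesis using d(2)[of h] True h by auto
        next
          case False
          have "integral {-x..-x + (-h)} (\<lambda>x. g (-x)) = \<phi> (- (-x)) - \<phi> (- (-x + (-h)))"
            using False by (intro integral_unique int') auto
          moreover have "(\<phi> x - \<phi> (x + h)) / (- h) = (\<phi> (x + h) - \<phi> x) / h"
            by (metis minus_diff_eq minus_divide_divide)
          ultimately show ?thesis using d'(2)[of "-h"] False h by (auto simp: add.commute)
        qed
      qed (use d d' in auto)
    qed
    then show ?thesis by (simp add: DERIV_def)
  qed
  have "negligible (N \<union> uminus ` N')"
    using N(1) \<open>negligible (uminus ` N')\<close> by simp
  then have "AE x in lebesgue. x \<notin> N \<union> uminus ` N'"
    unfolding negligible_iff_null_sets by (rule AE_not_in)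
  then have "AE x in lebesgue. (\<phi> has_real_derivative g x) (at x)"
    by eventually_elim (auto intro: der)
  then have "AE x in lborel. (\<phi> has_real_derivative g x) (at x)"
    by (simp add: AE_completion_iff)
  with g int show ?thesis using that by blast
qed

section \<open>Gradients of Lipschitz functions\<close>

text \<open>Cauchy's criterion expresses differentiability without naming the derivative and with
  countably many thresholds, which is what a measurability proof needs. The final inequality is
  non-strict so that the condition is closed under limits of the base point.\<close>

lemma differentiable_at_0_iff_Cauchy:
  fixes \<phi> :: "real \<Rightarrow> real"
  shows "\<phi> differentiable (at 0) \<longleftrightarrow>
    (\<forall>m::nat. \<exists>k::nat. \<forall>s t. s \<noteq> 0 \<and> t \<noteq> 0 \<and> \<bar>s\<bar> < 1 / Suc k \<and> \<bar>t\<bar> < 1 / Suc k \<longrightarrow>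
      \<bar>(\<phi> s - \<phi> 0) / s - (\<phi> t - \<phi> 0) / t\<bar> \<le> 1 / Suc m)"
    (is "_ \<longleftrightarrow> (\<forall>m. \<exists>k. ?C m k)")
proof
  define q where "q t = (\<phi> t - \<phi> 0) / t" for t
  {
    assume "\<phi> differentiable (at 0)"
    then obtain D where "(\<phi> has_real_derivative D) (at 0)"
      by (auto simp: real_differentiable_def)
    then have q: "(q \<longlongrightarrow> D) (at 0)"
      by (simp add: DERIV_def q_def[abs_def])
    show "\<forall>m. \<exists>k. ?C m k"
    proof
      fix m :: nat
      define e where "e = 1 / real (Suc m)"
      have "0 < e" by (simp add: e_def)
      have "\<forall>\<^sub>F t in at 0. dist (q t) D < e / 2"
        by (rule tendstoD[OF q half_gt_zero[OF \<open>0 < e\<close>]])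
      then obtain d where d: "0 < d" "\<And>t. t \<noteq> 0 \<Longrightarrow> \<bar>t\<bar> < d \<Longrightarrow> \<bar>q t - D\<bar> < e / 2"
        by (auto simp: eventually_at dist_real_def)
      obtain k :: nat where k: "1 / Suc k < d"
        by (rule nat_approx_posE[OF d(1)])
      show "\<exists>k. ?C m k"
      proof (intro exI[of _ k] allI impI)
        fix s t assume st: "s \<noteq> 0 \<and> t \<noteq> 0 \<and> \<bar>s\<bar> < 1 / Suc k \<and> \<bar>t\<bar> < 1 / Suc k"
        have "\<bar>s\<bar> < d" "\<bar>t\<bar> < d"
          by (rule less_trans[OF _ k]; use st in blast)+
        then have "\<bar>q s - D\<bar> < e / 2" "\<bar>q t - D\<bar> < e / 2"
          using st d(2)[of s] d(2)[of t] by blast+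
        then have "\<bar>q s - q t\<bar> \<le> e"
          by linarith
        then show "\<bar>(\<phi> s - \<phi> 0) / s - (\<phi> t - \<phi> 0) / t\<bar> \<le> 1 / Suc m"
          unfolding q_def e_def .
      qed
    qed
  next
    assume "\<forall>m. \<exists>k. ?C m k"
    then have C: "\<exists>k::nat. \<forall>s t. s \<noteq> 0 \<and> t \<noteq> 0 \<and> \<bar>s\<bar> < 1 / Suc k \<and> \<bar>t\<bar> < 1 / Suc k \<longrightarrow>
        \<bar>q s - q t\<bar> \<le> 1 / Suc m" for m :: nat
      unfolding q_def by (rule spec)
    \<comment> \<open>The derivative will be the limit of the quotients along the increments
      \<open>1 / Suc j\<close>.\<close>
    define r where "r j = q (1 / Suc j)" for j :: nat
    have C': "\<exists>d>0. \<forall>s t. s \<noteq> 0 \<longrightarrow> t \<noteq> 0 \<longrightarrow> \<bar>s\<bar> < d \<longrightarrow> \<bar>t\<bar> < d \<longrightarrow> \<bar>q s - q t\<bar> < e" if e: "0 < e" for e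
    proof -
      obtain m :: nat where m: "1 / Suc m < e" by (rule nat_approx_posE[OF e])
      obtain k :: nat where k: "\<forall>s t. s \<noteq> 0 \<and> t \<noteq> 0 \<and> \<bar>s\<bar> < 1 / Suc k \<and> \<bar>t\<bar> < 1 / Suc k \<longrightarrow>
          \<bar>q s - q t\<bar> \<le> 1 / Suc m"
        using C[of m] by blast
      show ?thesis
      proof (intro exI[of _ "1 / Suc k"] conjI allI impI)
        fix s t :: real
        assume "s \<noteq> 0" "t \<noteq> 0" "\<bar>s\<bar> < 1 / Suc k" "\<bar>t\<bar> < 1 / Suc k"
        then have "\<bar>q s - q t\<bar> \<le> 1 / Suc m" using k by blast
        then show "\<bar>q s - q t\<bar> < e" using m by linarith
      qed simp
    qed
    have ev: "\<forall>\<^sub>F j in sequentially. 1 / Suc j < d" if "0 < d" for d :: real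
    proof -
      have "(\<lambda>j. 1 / real (Suc j)) \<longlonglongrightarrow> 0" by (rule LIMSEQ_Suc[OF lim_1_over_n])
      then show ?thesis using that by (rule order_tendstoD)
    qed
    have "Cauchy r"
    proof (rule metric_CauchyI)
      fix e :: real assume "0 < e"
      then obtain d where d: "d > 0" "\<And>s t. s \<noteq> 0 \<Longrightarrow> t \<noteq> 0 \<Longrightarrow> \<bar>s\<bar> < d \<Longrightarrow> \<bar>t\<bar> < d \<Longrightarrow> \<bar>q s - q t\<bar> < e"
        using C' by blast
      obtain N where N: "\<And>j. j \<ge> N \<Longrightarrow> 1 / Suc j < d"
        using ev[OF d(1)] by (auto simp: eventually_sequentially)
      show "\<exists>M. \<forall>m\<ge>M. \<forall>n\<ge>M. dist (r m) (r n) < e"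
      proof (intro exI[of _ N] allI impI)
        fix m n assume "N \<le> m" "N \<le> n"
        then show "dist (r m) (r n) < e"
          unfolding r_def dist_real_def using N by (intro d(2)) auto
      qed
    qed
    then obtain D where D: "r \<longlonglongrightarrow> D" using Cauchy_convergent convergent_def by blast
    have "(q \<longlongrightarrow> D) (at 0)"
      unfolding tendsto_iff eventually_at dist_real_def
    proof (intro allI impI)
      fix e :: real assume "0 < e"
      then obtain d where d: "d > 0"
        "\<And>s t. s \<noteq> 0 \<Longrightarrow> t \<noteq> 0 \<Longrightarrow> \<bar>s\<bar> < d \<Longrightarrow> \<bar>t\<bar> < d \<Longrightarrow> \<bar>q s - q t\<bar> < e / 2"
        using C'[of "e / 2"] by auto
      show "\<exists>d>0. \<forall>x\<in>UNIV. x \<noteq> 0 \<and> \<bar>x - 0\<bar> < d \<longrightarrow> \<bar>q x - D\<bar> < e"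
      proof (intro exI[of _ d] conjI ballI impI)
        fix t assume t: "t \<noteq> 0 \<and> \<bar>t - 0\<bar> < d"
        have ev': "\<forall>\<^sub>F j in sequentially. \<bar>q t - r j\<bar> \<le> e / 2"
          using ev[OF d(1)]
        proof eventually_elim
          case (elim j)
          then show ?case unfolding r_def using t by (intro less_imp_le d(2)) auto
        qed
        have lim: "(\<lambda>j. \<bar>q t - r j\<bar>) \<longlonglongrightarrow> \<bar>q t - D\<bar>"
          by (intro tendsto_intros D)
        have "\<bar>q t - D\<bar> \<le> e / 2"
          by (rule tendsto_upperbound[OF lim ev']) simp
        then show "\<bar>q t - D\<bar> < e" using \<open>0 < e\<close> by simp
      qed (use d in auto)
    qed
    then have "(\<phi> has_real_derivative D) (at 0)"
      by (simp add: DERIV_def q_def[abs_def])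
    then show "\<phi> differentiable (at 0)"
      by (auto simp: real_differentiable_def)
  }
qed

lemma axis_eq_scaleR: "axis i t = t *\<^sub>R (axis i 1 :: real^'n)"
  by (simp add: vec_eq_iff axis_def)

lemma axis_0: "axis i 0 = (0 :: real^'n)"
  by (simp add: vec_eq_iff axis_def)

lemma continuous_on_axis [continuous_intros]:
  "continuous_on S g \<Longrightarrow> continuous_on S (\<lambda>x. axis i (g x) :: real^'n)"
  by (subst axis_eq_scaleR) (intro continuous_intros)

text \<open>
  For fixed bounds the Cauchy condition is an arbitrary intersection of closed sets in the base
  point, so no restriction to rational increments is needed.
\<close>

lemma sets_partially_differentiable:
  fixes f :: "real^'n \<Rightarrow> real"
  assumes f: "continuous_on UNIV f"
  shows "{x. (\<lambda>t. f (x + axis i t)) differentiable (at 0)} \<in> sets borel"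
proof -
  have f': "continuous_on UNIV (\<lambda>x. f (x + axis i t))" for t
    by (intro continuous_on_compose2[OF f] continuous_intros) auto
  \<comment> \<open>At \<open>t = 0\<close> the quotient is constantly 0 by the convention for
    division by 0, so continuity in \<open>x\<close> holds for every \<open>t\<close>.\<close>
  have quot: "continuous_on UNIV (\<lambda>x. (f (x + axis i t) - f (x + axis i 0)) / t)" for t
    by (cases "t = 0") (auto intro!: continuous_intros f')
  have "closed {x. \<forall>s t. s \<noteq> 0 \<and> t \<noteq> 0 \<and> \<bar>s\<bar> < 1 / Suc k \<and> \<bar>t\<bar> < 1 / Suc k \<longrightarrow>
      \<bar>(f (x + axis i s) - f (x + axis i 0)) / s - (f (x + axis i t) - f (x + axis i 0)) / t\<bar> \<le> 1 / Suc m}"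
    for k m :: nat
    by (intro closed_Collect_all closed_Collect_imp closed_Collect_le open_Collect_const
          continuous_on_rabs continuous_on_diff continuous_on_const quot)
  then have "(\<Inter>m::nat. \<Union>k::nat. {x. \<forall>s t. s \<noteq> 0 \<and> t \<noteq> 0 \<and> \<bar>s\<bar> < 1 / Suc k \<and> \<bar>t\<bar> < 1 / Suc k \<longrightarrow>
      \<bar>(f (x + axis i s) - f (x + axis i 0)) / s - (f (x + axis i t) - f (x + axis i 0)) / t\<bar> \<le> 1 / Suc m})
      \<in> sets borel"
    by (intro sets.countable_INT' sets.countable_UN' borel_closed) auto
  also have "(\<Inter>m::nat. \<Union>k::nat. {x. \<forall>s t. s \<noteq> 0 \<and> t \<noteq> 0 \<and> \<bar>s\<bar> < 1 / Suc k \<and> \<bar>t\<bar> < 1 / Suc k \<longrightarrow>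
      \<bar>(f (x + axis i s) - f (x + axis i 0)) / s - (f (x + axis i t) - f (x + axis i 0)) / t\<bar> \<le> 1 / Suc m})
    = {x. (\<lambda>t. f (x + axis i t)) differentiable (at 0)}"
    unfolding differentiable_at_0_iff_Cauchy by (rule set_eqI) (simp only: mem_Collect_eq INT_iff UN_iff UNIV_I bex_UNIV ball_UNIV simp_thms)
  finally show ?thesis .
qed

section \<open>Tonelli along coordinate lines; partial derivatives almost everywhere\<close>

lemma nn_integral_lborel_translate:
  fixes g :: "'a::euclidean_space \<Rightarrow> ennreal"
  assumes [measurable]: "g \<in> borel_measurable borel"
  shows "(\<integral>\<^sup>+x. g (x + c) \<partial>lborel) = (\<integral>\<^sup>+x. g x \<partial>lborel)"
proof -
  have "(\<integral>\<^sup>+x. g x \<partial>lborel) = (\<integral>\<^sup>+x. g x \<partial>distr lborel borel ((+) c))"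
    by (simp add: lborel_distr_plus)
  also have "\<dots> = (\<integral>\<^sup>+x. g (c + x) \<partial>lborel)"
    by (subst nn_integral_distr) auto
  finally show ?thesis by (simp add: add.commute)
qed

lemma borel_measurable_add_axis [measurable (raw)]:
  assumes [measurable]: "g \<in> borel_measurable M" "h \<in> borel_measurable M"
  shows "(\<lambda>x. g x + axis i (h x) :: real^'n) \<in> borel_measurable M"
  by (subst axis_eq_scaleR) measurable

text \<open>Serves two purposes: it carries null sets from lines to the whole space, and it turns a
  bound along lines into a bound for integrals over a box.\<close>

lemma nn_integral_line_Fubini:
  fixes g :: "real^'n \<Rightarrow> ennreal"
  assumes g [measurable]: "g \<in> borel_measurable borel" and [measurable]: "A \<in> sets borel" "T \<in> sets borel"
  shows "(\<integral>\<^sup>+x\<in>A. (\<integral>\<^sup>+t\<in>T. g (x + axis i t) \<partial>lborel) \<partial>lborel) =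
    (\<integral>\<^sup>+t\<in>T. (\<integral>\<^sup>+x\<in>A. g (x + axis i t) \<partial>lborel) \<partial>lborel)"
proof -
  have [measurable]: "(\<lambda>t. g (x + axis i t)) \<in> borel_measurable borel" for x by measurable
  have "(\<integral>\<^sup>+x\<in>A. (\<integral>\<^sup>+t\<in>T. g (x + axis i t) \<partial>lborel) \<partial>lborel) =
      (\<integral>\<^sup>+x. \<integral>\<^sup>+t. g (x + axis i t) * indicator T t * indicator A x \<partial>lborel \<partial>lborel)"
    by (intro nn_integral_cong nn_integral_multc[symmetric]) measurable
  also have "\<dots> = (\<integral>\<^sup>+t. \<integral>\<^sup>+x. g (x + axis i t) * indicator T t * indicator A x \<partial>lborel \<partial>lborel)"
    by (rule lborel_pair.Fubini'[symmetric]) measurable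
  also have "\<dots> = (\<integral>\<^sup>+t. \<integral>\<^sup>+x. (g (x + axis i t) * indicator A x) * indicator T t \<partial>lborel \<partial>lborel)"
    by (simp add: ac_simps)
  also have "\<dots> = (\<integral>\<^sup>+t\<in>T. (\<integral>\<^sup>+x\<in>A. g (x + axis i t) \<partial>lborel) \<partial>lborel)"
    by (intro nn_integral_cong nn_integral_multc) measurable
  finally show ?thesis .
qed

lemma lipschitz_on_line:
  fixes f :: "real^'n \<Rightarrow> real"
  assumes "L-lipschitz_on UNIV f"
  shows "L-lipschitz_on UNIV (\<lambda>t. f (x + axis i t))"
proof (rule lipschitz_onI)
  fix s t :: real
  have "dist (f (x + axis i s)) (f (x + axis i t)) \<le> L * dist (x + axis i s) (x + axis i t)"
    using assms by (rule lipschitz_onD) auto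
  also have "dist (x + axis i s) (x + axis i t) = norm ((s - t) *\<^sub>R (axis i 1 :: real^'n))"
    unfolding dist_norm by (rule arg_cong[where f = norm]) (simp add: vec_eq_iff axis_def)
  also have "\<dots> = dist s t" by (simp add: dist_norm)
  finally show "dist (f (x + axis i s)) (f (x + axis i t)) \<le> L * dist s t" .
qed (rule lipschitz_on_nonneg[OF assms])

text \<open>Links the one-variable theorem, which speaks of parameters \<open>s\<close> on a fixed
  line, with partial derivatives, which are taken at parameter 0 of the line through the point
  itself.\<close>

lemma line_DERIV_shift:
  fixes f :: "real^'n \<Rightarrow> real"
  shows "((\<lambda>t. f (x + axis i t)) has_real_derivative D) (at s) \<longleftrightarrow>
    ((\<lambda>t. f (x + axis i s + axis i t)) has_real_derivative D) (at 0)"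
proof -
  have "x + axis i (t + s) = x + axis i s + axis i t" for t
    by (simp add: vec_eq_iff axis_def)
  then show ?thesis
    using DERIV_shift[of "\<lambda>t. f (x + axis i t)" D 0 s] by (simp add: add.assoc)
qed

text \<open>Every line parallel to the axis meets the exceptional set in a null set. Averaging over
  translations by \<open>t\<close> in \<open>{0..1}\<close> exploits this without splitting the
  space into a line and a hyperplane.\<close>

lemma lipschitz_AE_partially_differentiable:
  fixes f :: "real^'n \<Rightarrow> real"
  assumes lip: "L-lipschitz_on UNIV f"
  shows "AE x in lborel. (\<lambda>t. f (x + axis i t)) differentiable (at 0)"
proof -
  define S where "S = {x. (\<lambda>t. f (x + axis i t)) differentiable (at 0)}"
  have S [measurable]: "S \<in> sets borel"
    unfolding S_def using lip by (intro sets_partially_differentiable lipschitz_on_continuous_on)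
  have line: "AE t in lborel. x + axis i t \<in> S" for x
  proof -
    obtain g where "AE t in lborel. ((\<lambda>t. f (x + axis i t)) has_real_derivative g t) (at t)"
      using lipschitz_AE_has_derivative[OF lipschitz_on_line[OF lip]] by blast
    then show ?thesis
      by eventually_elim (auto simp: S_def real_differentiable_def dest: line_DERIV_shift[THEN iffD1])
  qed
  \<comment> \<open>The unit interval has length 1, so an integral over \<open>t\<close> may be
    inserted; translation invariance then lets the set move with \<open>t\<close>.\<close>
  have "emeasure lborel (- S) = (\<integral>\<^sup>+t\<in>{0..1::real}. emeasure lborel (- S) \<partial>lborel)"
    by (simp add: nn_integral_cmult)
  also have "\<dots> = (\<integral>\<^sup>+t\<in>{0..1}. (\<integral>\<^sup>+x\<in>UNIV. indicator (- S) (x + axis i t) \<partial>lborel) \<partial>lborel)"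
    by (simp add: nn_integral_lborel_translate[of "indicator (- S)"])
  also have "\<dots> = (\<integral>\<^sup>+x\<in>UNIV. (\<integral>\<^sup>+t\<in>{0..1}. indicator (- S) (x + axis i t) \<partial>lborel) \<partial>lborel)"
    by (rule nn_integral_line_Fubini[symmetric]) measurable
  also have "\<dots> = (\<integral>\<^sup>+x. 0 \<partial>(lborel :: (real^'n) measure))"
  proof (intro nn_integral_cong)
    fix x :: "real^'n"
    have "(\<integral>\<^sup>+t\<in>{0..1}. indicator (- S) (x + axis i t) \<partial>lborel) = (\<integral>\<^sup>+t. 0 \<partial>(lborel :: real measure))"
      using line[of x] by (intro nn_integral_cong_AE) (auto elim!: eventually_mono)
    then show "(\<integral>\<^sup>+t\<in>{0..1}. indicator (- S) (x + axis i t) \<partial>lborel) * indicator UNIV x = 0"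
      by simp
  qed
  finally have "emeasure lborel (- S) = 0" by simp
  then have "- S \<in> null_sets lborel" by auto
  then have "AE x in lborel. x \<notin> - S" by (rule AE_not_in)
  then show ?thesis by eventually_elim (auto simp: S_def)
qed

text \<open>A gauge integral need not be absolutely convergent. If the right-hand side is infinite
  nothing is to be shown; otherwise \<open>g\<close> is Lebesgue integrable on the interval and both
  integrals agree.\<close>

lemma has_integral_abs_le_nn_integral:
  fixes g :: "real \<Rightarrow> real"
  assumes g [measurable]: "g \<in> borel_measurable borel" and I: "(g has_integral I) {a..b}"
  shows "ennreal \<bar>I\<bar> \<le> (\<integral>\<^sup>+t\<in>{a..b}. ennreal \<bar>g t\<bar> \<partial>lborel)"
proof (cases "(\<integral>\<^sup>+t\<in>{a..b}. ennreal \<bar>g t\<bar> \<partial>lborel) = \<infinity>")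
  case False
  have eq: "(\<integral>\<^sup>+t. ennreal (norm (indicator {a..b} t *\<^sub>R g t)) \<partial>lborel) = (\<integral>\<^sup>+t\<in>{a..b}. ennreal \<bar>g t\<bar> \<partial>lborel)"
    by (intro nn_integral_cong) (auto simp: indicator_def)
  have int: "integrable lborel (\<lambda>t. indicator {a..b} t *\<^sub>R g t)"
  proof (rule integrableI_bounded)
    show "(\<integral>\<^sup>+t. ennreal (norm (indicator {a..b} t *\<^sub>R g t)) \<partial>lborel) < \<infinity>"
      unfolding eq using False by (simp add: less_top)
  qed measurable
  then have "set_integrable lborel {a..b} g" by (simp add: set_integrable_def)
  then have "I = (LINT t:{a..b}|lborel. g t)"
    using set_borel_integral_eq_integral(2)[of "{a..b}" g] integral_unique[OF I] by simp
  then have "ennreal \<bar>I\<bar> = ennreal (norm (\<integral>t. indicator {a..b} t *\<^sub>R g t \<partial>lborel))"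
    by (simp add: set_lebesgue_integral_def)
  also have "\<dots> \<le> (\<integral>\<^sup>+t. ennreal (norm (indicator {a..b} t *\<^sub>R g t)) \<partial>lborel)"
    by (rule integral_norm_bound_ennreal[OF int])
  finally show ?thesis by (simp only: eq)
qed simp

text \<open>The bound holds for every \<open>x\<close>, not just almost every one: on each line the
  derivative exists at almost every parameter, and wherever it exists \<Gamma> equals it, so
  \<Gamma> may replace the density of the one-variable theorem.\<close>

lemma lipschitz_gradient:
  fixes f :: "real^'n \<Rightarrow> real"
  assumes lip: "L-lipschitz_on UNIV f"
  obtains \<Gamma> :: "real^'n \<Rightarrow> real^'n" where "\<Gamma> \<in> borel_measurable borel" "AE x in lborel. grad f x = \<Gamma> x"
    "\<And>x i h. 0 \<le> h \<Longrightarrow>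
      ennreal \<bar>f (x + axis i h) - f x\<bar> \<le> (\<integral>\<^sup>+t\<in>{0..h}. ennreal \<bar>\<Gamma> (x + axis i t) $ i\<bar> \<partial>lborel)"
proof -
  have cont: "continuous_on UNIV f" using lip by (rule lipschitz_on_continuous_on)
  have [measurable]: "f \<in> borel_measurable borel" by (rule borel_measurable_continuous_onI[OF cont])
  \<comment> \<open>A limit along a fixed sequence of increments is Borel on the whole space,
    whatever \<open>lim\<close> returns at points of divergence, and equals the partial derivative
    where that exists.\<close>
  define \<gamma> where "\<gamma> i x = lim (\<lambda>k::nat. (f (x + axis i (1 / Suc k)) - f x) / (1 / Suc k))" for i :: 'n and x
  define \<Gamma> where "\<Gamma> x = (\<chi> i. \<gamma> i x)" for x
  have \<Gamma>_nth: "\<Gamma> x $ i = \<gamma> i x" for x i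
    by (simp add: \<Gamma>_def)
  have "\<gamma> i \<in> borel_measurable borel" for i
    unfolding \<gamma>_def
    by (intro borel_measurable_lim_metric borel_measurable_continuous_onI continuous_intros
        continuous_on_compose2[OF cont]) auto
  then have 1: "\<Gamma> \<in> borel_measurable borel"
    unfolding \<Gamma>_def by (intro borel_measurable_euclidean_space[THEN iffD2]) (auto simp: Basis_vec_def inner_axis)
  have \<gamma>_eq: "\<gamma> i x = D" if "((\<lambda>t. f (x + axis i t)) has_real_derivative D) (at 0)" for i x D
  proof -
    have lim: "((\<lambda>h. (f (x + axis i h) - f x) / h) \<longlongrightarrow> D) (at 0)"
      using that by (simp add: DERIV_def axis_0)
    have "filterlim (\<lambda>k. 1 / real (Suc k)) (at 0) sequentially"
      unfolding filterlim_at using LIMSEQ_Suc[OF lim_1_over_n] by simp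
    from limI[OF filterlim_compose[OF lim this]] show ?thesis unfolding \<gamma>_def .
  qed
  have "AE x in lborel. \<forall>i\<in>UNIV. (\<lambda>t. f (x + axis i t)) differentiable (at 0)"
    by (rule AE_finite_allI) (auto intro: lipschitz_AE_partially_differentiable[OF lip])
  then have 2: "AE x in lborel. grad f x = \<Gamma> x"
  proof eventually_elim
    case (elim x)
    show ?case
    proof (intro vec_eq_iff[THEN iffD2] allI)
      fix i
      obtain D where D: "((\<lambda>t. f (x + axis i t)) has_real_derivative D) (at 0)"
        using elim by (auto simp: real_differentiable_def)
      show "grad f x $ i = \<Gamma> x $ i"
        using DERIV_imp_deriv[OF D] \<gamma>_eq[OF D] by (simp add: grad_def \<Gamma>_nth)
    qed
  qed
  have 3: "ennreal \<bar>f (x + axis i h) - f x\<bar> \<le> (\<integral>\<^sup>+t\<in>{0..h}. ennreal \<bar>\<Gamma> (x + axis i t) $ i\<bar> \<partial>lborel)"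
    if "0 \<le> h" for x i h
  proof -
    obtain g where g: "g \<in> borel_measurable borel"
      "\<And>a b. a \<le> b \<Longrightarrow> (g has_integral (f (x + axis i b) - f (x + axis i a))) {a..b}"
      "AE t in lborel. ((\<lambda>t. f (x + axis i t)) has_real_derivative g t) (at t)"
      using lipschitz_AE_has_derivative[OF lipschitz_on_line[OF lip]] by blast
    have "AE t in lborel. \<Gamma> (x + axis i t) $ i = g t"
      using g(3)
    proof eventually_elim
      case (elim t)
      then show ?case using \<gamma>_eq line_DERIV_shift \<Gamma>_nth by metis
    qed
    then have eq: "(\<integral>\<^sup>+t\<in>{0..h}. ennreal \<bar>g t\<bar> \<partial>lborel) =
        (\<integral>\<^sup>+t\<in>{0..h}. ennreal \<bar>\<Gamma> (x + axis i t) $ i\<bar> \<partial>lborel)"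
      by (intro nn_integral_cong_AE) (auto elim!: eventually_mono)
    have "ennreal \<bar>f (x + axis i h) - f (x + axis i 0)\<bar> \<le> (\<integral>\<^sup>+t\<in>{0..h}. ennreal \<bar>g t\<bar> \<partial>lborel)"
      by (intro has_integral_abs_le_nn_integral g that)
    also note eq
    finally show ?thesis by (simp add: axis_0)
  qed
  show ?thesis using that 1 2 3 by blast
qed

section \<open>Bisecting boxes\<close>

text \<open>One map serves both halves: applied to \<open>b\<close> it gives the upper corner of the
  lower half, applied to \<open>a\<close> the lower corner of the upper half.\<close>

definition halve :: "'n \<Rightarrow> real^'n \<Rightarrow> real^'n \<Rightarrow> real^'n \<Rightarrow> real^'n" where
  "halve i a b x = (\<chi> j. if j = i then (a $ i + b $ i) / 2 else x $ j)"

lemma halve_nth: "halve i a b x $ j = (if j = i then (a $ i + b $ i) / 2 else x $ j)"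
  by (simp add: halve_def)

lemma mem_lower_half:
  assumes "a $ i \<le> b $ i"
  shows "x \<in> cbox a (halve i a b b) \<longleftrightarrow> x \<in> cbox a b \<and> x $ i \<le> (a $ i + b $ i) / 2"
proof -
  have le: "(a $ i + b $ i) / 2 \<le> b $ i" using assms by simp
  have "x $ j \<le> b $ j" if "\<forall>j. x $ j \<le> halve i a b b $ j" for j
    using that[rule_format, of j] le by (cases "j = i") (simp_all add: halve_nth)
  moreover have "x $ i \<le> (a $ i + b $ i) / 2" if "\<forall>j. x $ j \<le> halve i a b b $ j"
    using that[rule_format, of i] by (simp add: halve_nth)
  moreover have "x $ j \<le> halve i a b b $ j" if "\<forall>j. x $ j \<le> b $ j" "x $ i \<le> (a $ i + b $ i) / 2" for j
    using that by (simp add: halve_nth)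
  ultimately show ?thesis unfolding mem_box_cart by blast
qed

lemma mem_upper_half:
  assumes "a $ i \<le> b $ i"
  shows "x \<in> cbox (halve i a b a) b \<longleftrightarrow> x \<in> cbox a b \<and> (a $ i + b $ i) / 2 \<le> x $ i"
proof -
  have le: "a $ i \<le> (a $ i + b $ i) / 2" using assms by simp
  have "a $ j \<le> x $ j" if "\<forall>j. halve i a b a $ j \<le> x $ j" for j
    using that[rule_format, of j] le by (cases "j = i") (simp_all add: halve_nth)
  moreover have "(a $ i + b $ i) / 2 \<le> x $ i" if "\<forall>j. halve i a b a $ j \<le> x $ j"
    using that[rule_format, of i] by (simp add: halve_nth)
  moreover have "halve i a b a $ j \<le> x $ j" if "\<forall>j. a $ j \<le> x $ j" "(a $ i + b $ i) / 2 \<le> x $ i" for j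
    using that by (simp add: halve_nth)
  ultimately show ?thesis unfolding mem_box_cart by blast
qed

lemma measure_cbox_cart:
  fixes a b :: "real^'n"
  assumes "\<And>j. a $ j \<le> b $ j"
  shows "measure lebesgue (cbox a b) = (\<Prod>j\<in>UNIV. b $ j - a $ j)"
proof -
  have "measure lebesgue (cbox a b) = measure lborel (cbox a b)" by simp
  also have "\<dots> = (\<Prod>j\<in>UNIV. b $ j - a $ j)"
    using assms by (intro content_cbox_cart) (simp add: interval_ne_empty_cart)
  finally show ?thesis .
qed

lemma measure_half:
  fixes a b :: "real^'n"
  assumes "\<And>j. a $ j \<le> b $ j"
  shows "measure lebesgue (cbox a (halve i a b b)) = measure lebesgue (cbox a b) / 2"
    and "measure lebesgue (cbox (halve i a b a) b) = measure lebesgue (cbox a b) / 2"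
proof -
  have 1: "a $ j \<le> halve i a b b $ j" "halve i a b a $ j \<le> b $ j" for j
    using assms[of j] by (auto simp: halve_nth)
  have split: "(\<Prod>j\<in>UNIV. g j) = g i * (\<Prod>j\<in>UNIV - {i}. g j)" for g :: "'n \<Rightarrow> real"
    by (rule prod.remove) auto
  have half: "(a $ i + b $ i) / 2 - a $ i = (b $ i - a $ i) / 2" "b $ i - (a $ i + b $ i) / 2 = (b $ i - a $ i) / 2"
    by (simp_all add: field_simps)
  have eq: "(\<Prod>j\<in>UNIV - {i}. halve i a b b $ j - a $ j) = (\<Prod>j\<in>UNIV - {i}. b $ j - a $ j)"
    "(\<Prod>j\<in>UNIV - {i}. b $ j - halve i a b a $ j) = (\<Prod>j\<in>UNIV - {i}. b $ j - a $ j)"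
    by (auto intro!: prod.cong simp: halve_nth)
  show "measure lebesgue (cbox a (halve i a b b)) = measure lebesgue (cbox a b) / 2"
    "measure lebesgue (cbox (halve i a b a) b) = measure lebesgue (cbox a b) / 2"
    unfolding measure_cbox_cart[OF 1(1)] measure_cbox_cart[OF 1(2)] measure_cbox_cart[OF assms]
      split[of "\<lambda>j. halve i a b b $ j - a $ j"] split[of "\<lambda>j. b $ j - halve i a b a $ j"]
      split[of "\<lambda>j. b $ j - a $ j"] eq
    by (simp_all add: halve_nth half)
qed

text \<open>The closed halves overlap in a piece of the hyperplane through the midpoint, which is a
  null set.\<close>

lemma AE_halves:
  fixes a b :: "real^'n"
  assumes "a $ i \<le> b $ i"
  shows "AE x in lebesgue. (x \<in> cbox a b \<longleftrightarrow> x \<in> cbox a (halve i a b b) \<or> x \<in> cbox (halve i a b a) b) \<and>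
    \<not> (x \<in> cbox a (halve i a b b) \<and> x \<in> cbox (halve i a b a) b)"
proof -
  have "negligible {x :: real^'n. x $ i = (a $ i + b $ i) / 2}"
    using negligible_standard_hyperplane[of "axis i 1 :: real^'n" "(a $ i + b $ i) / 2"] by (simp add: inner_axis axis_in_Basis_iff)
  then have "AE x in lebesgue. x \<notin> {x :: real^'n. x $ i = (a $ i + b $ i) / 2}"
    unfolding negligible_iff_null_sets by (rule AE_not_in)
  then show ?thesis
    by eventually_elim (auto simp: mem_lower_half[OF assms] mem_upper_half[OF assms])
qed

lemma nn_integral_halves:
  fixes a b :: "real^'n"
  assumes ab: "a $ i \<le> b $ i" and g: "g \<in> borel_measurable lebesgue"
  shows "(\<integral>\<^sup>+x\<in>cbox a b. g x \<partial>lebesgue) =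
    (\<integral>\<^sup>+x\<in>cbox a (halve i a b b). g x \<partial>lebesgue) + (\<integral>\<^sup>+x\<in>cbox (halve i a b a) b. g x \<partial>lebesgue)"
proof -
  have "(\<integral>\<^sup>+x\<in>cbox a b. g x \<partial>lebesgue) =
      (\<integral>\<^sup>+x. g x * indicator (cbox a (halve i a b b)) x + g x * indicator (cbox (halve i a b a) b) x \<partial>lebesgue)"
    by (rule nn_integral_cong_AE, use AE_halves[where a = a and b = b and i = i, OF ab] in eventually_elim)
      (auto simp: indicator_def)
  also have "\<dots> = (\<integral>\<^sup>+x\<in>cbox a (halve i a b b). g x \<partial>lebesgue) + (\<integral>\<^sup>+x\<in>cbox (halve i a b a) b. g x \<partial>lebesgue)"
    by (intro nn_integral_add borel_measurable_times_ennreal borel_measurable_indicator g) auto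
  finally show ?thesis .
qed

text \<open>Averages are taken over \<open>lebesgue\<close>, while translation and Tonelli are
  available on \<open>lborel\<close>; this is the passage between them.\<close>

lemma set_integrable_cbox_lebesgue:
  fixes f :: "real^'n \<Rightarrow> real"
  assumes "continuous_on UNIV f"
  shows "set_integrable lborel (cbox a b) f" "set_integrable lebesgue (cbox a b) f"
    "(LINT x:cbox a b|lebesgue. f x) = (LINT x:cbox a b|lborel. f x)"
proof -
  have [measurable]: "f \<in> borel_measurable borel"
    using assms by (rule borel_measurable_continuous_onI)
  show int: "set_integrable lborel (cbox a b) f"
    unfolding set_integrable_def
    by (rule borel_integrable_compact[OF compact_cbox continuous_on_subset[OF assms subset_UNIV]])
  then show "set_integrable lebesgue (cbox a b) f"
    unfolding set_integrable_def by (subst integrable_completion) auto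
  show "(LINT x:cbox a b|lebesgue. f x) = (LINT x:cbox a b|lborel. f x)"
    unfolding set_lebesgue_integral_def by (rule integral_completion) measurable
qed

lemma integral_halves:
  fixes f :: "real^'n \<Rightarrow> real"
  assumes ab: "a $ i \<le> b $ i" and f: "continuous_on UNIV f"
  shows "(LINT x:cbox a b|lebesgue. f x) =
    (LINT x:cbox a (halve i a b b)|lebesgue. f x) + (LINT x:cbox (halve i a b a) b|lebesgue. f x)"
proof -
  have int: "integrable lebesgue (\<lambda>x. indicator (cbox c d) x *\<^sub>R f x)" for c d
    using set_integrable_cbox_lebesgue(2)[OF f] by (simp add: set_integrable_def)
  have "(LINT x:cbox a b|lebesgue. f x) =
      (\<integral>x. indicator (cbox a (halve i a b b)) x *\<^sub>R f x + indicator (cbox (halve i a b a) b) x *\<^sub>R f x \<partial>lebesgue)"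
    unfolding set_lebesgue_integral_def
    by (intro integral_cong_AE borel_measurable_add borel_measurable_integrable[OF int],
        use AE_halves[where a = a and b = b and i = i, OF ab] in eventually_elim)
      (auto simp: indicator_def)
  also have "\<dots> = (LINT x:cbox a (halve i a b b)|lebesgue. f x) + (LINT x:cbox (halve i a b a) b|lebesgue. f x)"
    unfolding set_lebesgue_integral_def by (rule Bochner_Integration.integral_add[OF int int])
  finally show ?thesis .
qed

lemma lower_half_translate:
  assumes "x \<in> cbox a (halve i a b b)" "0 \<le> t" "t \<le> (b $ i - a $ i) / 2" "a $ i \<le> b $ i"
  shows "x + axis i t \<in> cbox a b"
proof -
  have x: "x $ i \<le> (a $ i + b $ i) / 2" "a $ j \<le> x $ j" "x $ j \<le> b $ j" for j
    using assms mem_lower_half[of a i b x] by (auto simp: mem_box_cart)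
  have "a $ j \<le> (x + axis i t) $ j \<and> (x + axis i t) $ j \<le> b $ j" for j
    using x(1) x(2,3)[of j] assms(2,3) by (cases "j = i") (simp_all add: axis_def)
  then show ?thesis by (simp add: mem_box_cart)
qed

lemma halves_translate:
  fixes a b x :: "real^'n"
  assumes "a $ i \<le> b $ i"
  shows "x + axis i ((b $ i - a $ i) / 2) \<in> cbox (halve i a b a) b \<longleftrightarrow> x \<in> cbox a (halve i a b b)"
proof -
  have "(\<lambda>j. halve i a b a $ j \<le> (x + axis i ((b $ i - a $ i) / 2)) $ j \<and> (x + axis i ((b $ i - a $ i) / 2)) $ j \<le> b $ j)
      = (\<lambda>j. a $ j \<le> x $ j \<and> x $ j \<le> halve i a b b $ j)"
    by (auto simp: fun_eq_iff halve_nth axis_def field_simps)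
  then show ?thesis by (simp add: mem_box_cart fun_eq_iff)
qed

text \<open>With \<open>h\<close> half the side, the upper half is the lower one shifted by
  \<open>h\<close>, so the difference is the integral of an increment of \<open>f\<close> over the
  lower half. After Tonelli, every shift of the lower half by some \<open>t\<close> in
  \<open>{0..h}\<close> still lies in the box; the inner integral is thus bounded independently of
  \<open>t\<close>, and integrating over \<open>t\<close> gives the factor \<open>h\<close>.\<close>

lemma diff_halves_bound:
  fixes f :: "real^'n \<Rightarrow> real" and \<Gamma> :: "real^'n \<Rightarrow> real^'n"
  assumes f: "continuous_on UNIV f" and \<Gamma> [measurable]: "\<Gamma> \<in> borel_measurable borel"
    and line: "\<And>x h. 0 \<le> h \<Longrightarrow>
      ennreal \<bar>f (x + axis i h) - f x\<bar> \<le> (\<integral>\<^sup>+t\<in>{0..h}. ennreal \<bar>\<Gamma> (x + axis i t) $ i\<bar> \<partial>lborel)"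
    and ab: "a $ i \<le> b $ i"
  shows "ennreal \<bar>(LINT x:cbox (halve i a b a) b|lebesgue. f x) - (LINT x:cbox a (halve i a b b)|lebesgue. f x)\<bar>
    \<le> ennreal ((b $ i - a $ i) / 2) * (\<integral>\<^sup>+x\<in>cbox a b. ennreal (norm (\<Gamma> x)) \<partial>lborel)"
proof -
  define h where "h = (b $ i - a $ i) / 2"
  have "0 \<le> h" using ab by (simp add: h_def)
  let ?B1 = "cbox a (halve i a b b)" and ?B2 = "cbox (halve i a b a) b"
  have [measurable]: "f \<in> borel_measurable borel"
    using f by (rule borel_measurable_continuous_onI)
  have f': "continuous_on UNIV (\<lambda>x. f (x + axis i h))"
    by (intro continuous_on_compose2[OF f] continuous_intros) auto
  have "(LINT x:?B2|lborel. f x) = (\<integral>x. indicator ?B2 x *\<^sub>R f x \<partial>distr lborel borel ((+) (axis i h)))"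
    by (simp add: set_lebesgue_integral_def lborel_distr_plus)
  also have "\<dots> = (\<integral>x. indicator ?B2 (x + axis i h) *\<^sub>R f (x + axis i h) \<partial>lborel)"
    by (subst integral_distr) (auto simp: add.commute)
  also have "\<dots> = (LINT x:?B1|lborel. f (x + axis i h))"
    unfolding set_lebesgue_integral_def
    by (intro Bochner_Integration.integral_cong refl) (simp add: indicator_def h_def halves_translate[OF ab])
  finally have "(LINT x:?B2|lebesgue. f x) - (LINT x:?B1|lebesgue. f x) = (LINT x:?B1|lborel. f (x + axis i h) - f x)"
    using set_integrable_cbox_lebesgue[OF f] set_integrable_cbox_lebesgue[OF f'] by (simp add: set_integral_diff)
  also have "ennreal \<bar>\<dots>\<bar> \<le> (\<integral>\<^sup>+x. ennreal (norm (indicator ?B1 x *\<^sub>R (f (x + axis i h) - f x))) \<partial>lborel)"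
    unfolding set_lebesgue_integral_def real_norm_def[symmetric]
    using set_integrable_cbox_lebesgue(1)[OF continuous_on_diff[OF f' f]]
    by (intro integral_norm_bound_ennreal) (simp add: set_integrable_def)
  also have "\<dots> \<le> (\<integral>\<^sup>+x\<in>?B1. (\<integral>\<^sup>+t\<in>{0..h}. ennreal (norm (\<Gamma> (x + axis i t))) \<partial>lborel) \<partial>lborel)"
  proof (rule nn_integral_mono)
    fix x
    have "ennreal \<bar>f (x + axis i h) - f x\<bar> \<le> (\<integral>\<^sup>+t\<in>{0..h}. ennreal \<bar>\<Gamma> (x + axis i t) $ i\<bar> \<partial>lborel)"
      by (rule line) fact
    also have "\<dots> \<le> (\<integral>\<^sup>+t\<in>{0..h}. ennreal (norm (\<Gamma> (x + axis i t))) \<partial>lborel)"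
      by (intro nn_integral_mono mult_right_mono ennreal_leI component_le_norm_cart) auto
    finally show "ennreal (norm (indicator ?B1 x *\<^sub>R (f (x + axis i h) - f x))) \<le>
        (\<integral>\<^sup>+t\<in>{0..h}. ennreal (norm (\<Gamma> (x + axis i t))) \<partial>lborel) * indicator ?B1 x"
      by (simp add: indicator_def)
  qed
  also have "\<dots> = (\<integral>\<^sup>+t\<in>{0..h}. (\<integral>\<^sup>+x\<in>?B1. ennreal (norm (\<Gamma> (x + axis i t))) \<partial>lborel) \<partial>lborel)"
    by (rule nn_integral_line_Fubini) measurable
  also have "\<dots> \<le> (\<integral>\<^sup>+t\<in>{0..h}. (\<integral>\<^sup>+x\<in>cbox a b. ennreal (norm (\<Gamma> x)) \<partial>lborel) \<partial>lborel)"
  proof (rule nn_integral_mono)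
    fix t
    show "(\<integral>\<^sup>+x\<in>?B1. ennreal (norm (\<Gamma> (x + axis i t))) \<partial>lborel) * indicator {0..h} t \<le>
      (\<integral>\<^sup>+x\<in>cbox a b. ennreal (norm (\<Gamma> x)) \<partial>lborel) * indicator {0..h} t"
    proof (cases "t \<in> {0..h}")
      case True
      have "(\<integral>\<^sup>+x\<in>?B1. ennreal (norm (\<Gamma> (x + axis i t))) \<partial>lborel) \<le>
          (\<integral>\<^sup>+x. ennreal (norm (\<Gamma> (x + axis i t))) * indicator (cbox a b) (x + axis i t) \<partial>lborel)"
        using True ab by (intro nn_integral_mono) (auto simp: indicator_def h_def dest: lower_half_translate)
      also have "\<dots> = (\<integral>\<^sup>+x\<in>cbox a b. ennreal (norm (\<Gamma> x)) \<partial>lborel)"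
        by (rule nn_integral_lborel_translate) measurable
      finally show ?thesis by (rule mult_right_mono) simp
    qed simp
  qed
  also have "\<dots> = ennreal h * (\<integral>\<^sup>+x\<in>cbox a b. ennreal (norm (\<Gamma> x)) \<partial>lborel)"
    using \<open>0 \<le> h\<close> by (subst nn_integral_cmult_indicator) (auto simp: mult.commute)
  finally show ?thesis by (simp add: h_def)
qed

lemma average_half_diff:
  fixes f :: "real^'n \<Rightarrow> real" and \<Gamma> :: "real^'n \<Rightarrow> real^'n"
  assumes f: "continuous_on UNIV f" and \<Gamma> [measurable]: "\<Gamma> \<in> borel_measurable borel"
    and line: "\<And>x h. 0 \<le> h \<Longrightarrow>
      ennreal \<bar>f (x + axis i h) - f x\<bar> \<le> (\<integral>\<^sup>+t\<in>{0..h}. ennreal \<bar>\<Gamma> (x + axis i t) $ i\<bar> \<partial>lborel)"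
    and ab: "\<And>j. a $ j < b $ j"
    and B': "B' = cbox a (halve i a b b) \<or> B' = cbox (halve i a b a) b"
  shows "ennreal \<bar>avg B' f - avg (cbox a b) f\<bar> \<le>
    ennreal ((b $ i - a $ i) / 2 / measure lebesgue (cbox a b)) * (\<integral>\<^sup>+x\<in>cbox a b. ennreal (norm (\<Gamma> x)) \<partial>lborel)"
proof -
  have ab': "\<And>j. a $ j \<le> b $ j" using ab less_imp_le by blast
  define V where "V = measure lebesgue (cbox a b)"
  have V: "V > 0" using ab unfolding V_def measure_cbox_cart[OF ab'] by (intro prod_pos) auto
  define I1 where "I1 = (LINT x:cbox a (halve i a b b)|lebesgue. f x)"
  define I2 where "I2 = (LINT x:cbox (halve i a b a) b|lebesgue. f x)"
  \<comment> \<open>A half has volume \<open>V / 2\<close>: for the lower one,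
    \<open>2 * I1 / V - (I1 + I2) / V\<close> is \<open>(I1 - I2) / V\<close>.\<close>
  have "avg B' f - avg (cbox a b) f = (I1 - I2) / V \<or> avg B' f - avg (cbox a b) f = (I2 - I1) / V"
    using B' integral_halves[of a i b f, OF ab' f] measure_half[of a b i, OF ab']
    by (auto simp: avg_def I1_def I2_def V_def[symmetric] add_divide_distrib diff_divide_distrib)
  then have "\<bar>avg B' f - avg (cbox a b) f\<bar> = \<bar>I2 - I1\<bar> / V"
    using V by (auto simp: abs_minus_commute)
  then have "ennreal \<bar>avg B' f - avg (cbox a b) f\<bar> = ennreal (1 / V) * ennreal \<bar>I2 - I1\<bar>"
    using V by (simp flip: ennreal_mult)
  also have "\<dots> \<le> ennreal (1 / V) * (ennreal ((b $ i - a $ i) / 2) * (\<integral>\<^sup>+x\<in>cbox a b. ennreal (norm (\<Gamma> x)) \<partial>lborel))"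
    unfolding I1_def I2_def by (intro mult_left_mono diff_halves_bound f \<Gamma> line ab') auto
  also have "\<dots> = ennreal ((b $ i - a $ i) / 2 / V) * (\<integral>\<^sup>+x\<in>cbox a b. ennreal (norm (\<Gamma> x)) \<partial>lborel)"
    using V ab'[of i] by (simp add: mult.assoc[symmetric] ennreal_mult[symmetric] mult.commute[of V])
  finally show ?thesis by (simp add: V_def)
qed

section \<open>The two-weight condition\<close>

lemma ennpowr_ennreal: "0 \<le> x \<Longrightarrow> 0 < a \<Longrightarrow> ennpowr (ennreal x) a = ennreal (x powr a)"
  by (auto simp: ennpowr_def)

lemma ennpowr_ennreal_pos: "0 < x \<Longrightarrow> ennpowr (ennreal x) a = ennreal (x powr a)"
  by (auto simp: ennpowr_def)

lemma ennpowr_0 [simp]: "0 < a \<Longrightarrow> ennpowr 0 a = 0"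
  by (simp add: ennpowr_def)

lemma ennpowr_top [simp]: "0 < a \<Longrightarrow> ennpowr top a = top"
  by (simp add: ennpowr_def)

lemma ennpowr_mono:
  assumes "x \<le> y" "0 < a"
  shows "ennpowr x a \<le> ennpowr y a"
proof (cases y)
  case (real s)
  then obtain r where "x = ennreal r" "0 \<le> r" "r \<le> s"
    using assms(1) by (cases x) (auto simp: top_unique)
  then show ?thesis
    using real assms(2) by (auto simp: ennpowr_ennreal intro!: ennreal_leI powr_mono2)
qed (use assms in simp)

lemma ennpowr_mult:
  assumes "0 < a"
  shows "ennpowr (x * y) a = ennpowr x a * ennpowr y a"
proof (cases x; cases y)
  fix r s assume "0 \<le> r" "x = ennreal r" "0 \<le> s" "y = ennreal s"
  then show ?thesis
    using assms by (simp add: ennpowr_ennreal powr_mult flip: ennreal_mult)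
next
  fix r assume "0 \<le> r" "x = ennreal r" "y = top"
  then show ?thesis using assms
    by (cases "r = 0") (simp_all add: ennpowr_ennreal ennreal_mult_top)
next
  fix r assume "x = top" "0 \<le> r" "y = ennreal r"
  then show ?thesis using assms
    by (cases "r = 0") (simp_all add: ennpowr_ennreal ennreal_top_mult)
qed (use assms in simp)

lemma borel_measurable_ennpowr:
  assumes [measurable]: "v \<in> borel_measurable M" and v0: "\<And>x. 0 \<le> v x"
  shows "(\<lambda>x. ennpowr (ennreal (v x)) a) \<in> borel_measurable M"
proof -
  have "(\<lambda>x. ennpowr (ennreal (v x)) a) =
      (\<lambda>x. if v x = 0 then ennpowr 0 a else ennreal (v x powr a))"
    using v0 by (auto simp: fun_eq_iff ennpowr_ennreal_pos less_le)
  also have "\<dots> \<in> borel_measurable M" by measurable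
  finally show ?thesis .
qed

text \<open>Young's inequality for \<open>g * v powr (1 / p)\<close> and
  \<open>y powr (p - 1) * v powr (- 1 / p)\<close>. The free parameter \<open>y\<close> allows
  integrating first and optimising afterwards.\<close>

lemma Young_weighted:
  fixes p g v y :: real
  assumes p: "1 < p" and "0 \<le> g" "0 < v" "0 < y"
  shows "p * y powr (p - 1) * g \<le> g powr p * v + (p - 1) * y powr p * v powr (1 - conj_exp p)"
proof -
  define q where "q = conj_exp p"
  have q: "q = p / (p - 1)" by (simp add: q_def conj_exp_def)
  have q1: "1 < q" and conj: "1 / p + 1 / q = 1"
    using p by (simp_all add: q field_simps)
  have e1: "(p - 1) * q = p" "1 - q = - (q / p)" "p / q = p - 1"
    using p by (simp_all add: q field_simps)
  have "g * v powr (1 / p) * (y powr (p - 1) * v powr (- 1 / p)) \<le>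
      (g * v powr (1 / p)) powr p / p + (y powr (p - 1) * v powr (- 1 / p)) powr q / q"
    using assms q1 conj by (intro Youngs_inequality) auto
  also have "g * v powr (1 / p) * (y powr (p - 1) * v powr (- 1 / p)) =
      g * y powr (p - 1) * (v powr (1 / p) * v powr (- 1 / p))"
    by simp
  also have "v powr (1 / p) * v powr (- 1 / p) = 1"
    using assms by (simp flip: powr_add)
  also have "(g * v powr (1 / p)) powr p = g powr p * v"
    using assms by (simp add: powr_mult powr_powr)
  also have "(y powr (p - 1) * v powr (- 1 / p)) powr q = y powr p * v powr (1 - q)"
    using assms e1 by (simp add: powr_mult powr_powr)
  finally have "g * y powr (p - 1) \<le> g powr p * v / p + y powr p * v powr (1 - q) / q"
    by simp
  then have "p * (g * y powr (p - 1)) \<le> p * (g powr p * v / p + y powr p * v powr (1 - q) / q)"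
    using p by (intro mult_left_mono) auto
  also have "\<dots> = g powr p * v + (p / q) * y powr p * v powr (1 - q)"
    using p by (simp add: field_simps)
  also note e1(3)
  finally show ?thesis
    by (simp add: q_def mult.assoc mult.commute[of g])
qed

text \<open>Integrate the weighted Young inequality and choose the best \<open>y\<close>. The
  finiteness assumption excludes the case \<open>v = 0\<close>, where the right-hand side would be
  \<open>0 * top = 0\<close>.\<close>

lemma Holder_weighted:
  fixes g v :: "'a \<Rightarrow> real"
  assumes p: "1 < p" and [measurable]: "g \<in> borel_measurable M" "v \<in> borel_measurable M"
    and g0: "\<And>x. 0 \<le> g x" and v0: "\<And>x. 0 \<le> v x"
    and S: "(\<integral>\<^sup>+x. ennpowr (ennreal (v x)) (1 - conj_exp p) \<partial>M) < top"
  shows "ennpowr (\<integral>\<^sup>+x. ennreal (g x) \<partial>M) p \<le>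
    (\<integral>\<^sup>+x. ennreal (g x powr p * v x) \<partial>M) *
    ennpowr (\<integral>\<^sup>+x. ennpowr (ennreal (v x)) (1 - conj_exp p) \<partial>M) (p - 1)"
proof -
  define r where "r = 1 - conj_exp p"
  have r: "r < 0" using p by (simp add: r_def conj_exp_def field_simps)
  define S where "S = (\<integral>\<^sup>+x. ennpowr (ennreal (v x)) r \<partial>M)"
  define I where "I = (\<integral>\<^sup>+x. ennreal (g x) \<partial>M)"
  define G where "G = (\<integral>\<^sup>+x. ennreal (g x powr p * v x) \<partial>M)"
  have meas [measurable]: "(\<lambda>x. ennpowr (ennreal (v x)) r) \<in> borel_measurable M"
    by (rule borel_measurable_ennpowr) (auto simp: v0)
  have Sfin: "S < top" using assms(6) by (simp add: S_def r_def)
  \<comment> \<open>At a zero of \<open>v\<close> the negative power is infinite, so finiteness of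
    \<open>S\<close> forces \<open>v\<close> to be positive almost everywhere.\<close>
  have "AE x in M. ennpowr (ennreal (v x)) r \<noteq> \<infinity>"
    using Sfin by (intro nn_integral_PInf_AE) (auto simp: S_def)
  then have vpos: "AE x in M. 0 < v x"
  proof eventually_elim
    case (elim x)
    then show ?case using r v0[of x] by (cases "v x = 0") (auto simp: ennpowr_def)
  qed
  have Y: "ennreal (p * y powr (p - 1)) * I \<le> G + ennreal ((p - 1) * y powr p) * S" if y: "0 < y" for y
  proof -
    have "ennreal (p * y powr (p - 1)) * I = (\<integral>\<^sup>+x. ennreal (p * y powr (p - 1)) * ennreal (g x) \<partial>M)"
      unfolding I_def by (rule nn_integral_cmult[symmetric]) measurable
    also have "\<dots> \<le> (\<integral>\<^sup>+x. ennreal (g x powr p * v x) + ennreal ((p - 1) * y powr p) * ennpowr (ennreal (v x)) r \<partial>M)"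
    proof (rule nn_integral_mono_AE, use vpos in eventually_elim)
      case (elim x)
      have "ennreal (p * y powr (p - 1)) * ennreal (g x) = ennreal (p * y powr (p - 1) * g x)"
        using p g0[of x] by (simp add: ennreal_mult)
      also have "\<dots> \<le> ennreal (g x powr p * v x + (p - 1) * y powr p * v x powr r)"
        unfolding r_def using Young_weighted[OF p g0 elim y] by (rule ennreal_leI)
      also have "\<dots> = ennreal (g x powr p * v x) + ennreal ((p - 1) * y powr p) * ennpowr (ennreal (v x)) r"
        using p elim by (simp add: ennpowr_ennreal_pos ennreal_mult ennreal_plus)
      finally show ?case .
    qed
    also have "\<dots> = G + ennreal ((p - 1) * y powr p) * S"
      unfolding G_def S_def by (simp add: nn_integral_add nn_integral_cmult)
    finally show ?thesis .
  qed
  have "ennpowr I p \<le> G * ennpowr S (p - 1)"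
  proof (cases "S = 0")
    case True
    then have "AE x in M. ennpowr (ennreal (v x)) r = 0"
      by (simp add: S_def nn_integral_0_iff_AE)
    \<comment> \<open>A power of a positive real is never 0, so \<open>S = 0\<close> means that the
      whole space is null.\<close>
    then have "AE x in M. False"
      using vpos by eventually_elim (simp add: ennpowr_ennreal_pos)
    then have "AE x in M. ennreal (g x) = 0" by eventually_elim simp
    then have "I = 0" by (simp add: I_def nn_integral_0_iff_AE)
    then show ?thesis using p by simp
  next
    case False
    then obtain s where s: "S = ennreal s" "0 < s"
      using Sfin by (cases S) (auto simp: less_le)
    show ?thesis
    proof (cases "G = top")
      case True
      then show ?thesis using s p by (simp add: ennpowr_ennreal ennreal_top_mult)
    next
      case False
      then obtain c where c: "G = ennreal c" "0 \<le> c" by (cases G) auto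
      \<comment> \<open>The choice \<open>y = 1\<close> serves only to show that \<open>I\<close> is
        finite.\<close>
      have "ennreal p * I \<le> ennreal (c + (p - 1) * s)"
        using Y[of 1] p s c by (simp flip: ennreal_plus ennreal_mult)
      then obtain J where J: "I = ennreal J" "0 \<le> J"
        using p by (cases I) (auto simp: ennreal_mult_top top_unique)
      show ?thesis
      proof (cases "J = 0")
        case True
        then show ?thesis using J p by simp
      next
        case False
        \<comment> \<open>This \<open>y\<close> maximises
          \<open>p * y powr (p - 1) * J - (p - 1) * y powr p * s\<close>.\<close>
        define y where "y = J / s"
        have y: "0 < y" using False J s by (simp add: y_def)
        have "ennreal (p * y powr (p - 1) * J) \<le> ennreal (c + (p - 1) * y powr p * s)"
          using Y[OF y] J s c p by (simp add: ennreal_mult ennreal_plus)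
        then have "p * y powr (p - 1) * J \<le> c + (p - 1) * y powr p * s"
          by (subst (asm) ennreal_le_iff) (use c p s in auto)
        moreover have "y powr p * s = y powr (p - 1) * J"
          using y s J(2) powr_add[of y "p - 1" 1] by (simp add: y_def)
        ultimately have "y powr (p - 1) * J \<le> c"
          by (simp add: algebra_simps)
        moreover have "y powr (p - 1) * J * s powr (p - 1) = J powr p"
          using J s False powr_add[of J "p - 1" 1] by (simp add: y_def powr_divide)
        ultimately have "J powr p \<le> c * s powr (p - 1)"
          by (metis mult_right_mono powr_ge_zero)
        then show ?thesis
          using J s c p by (simp add: ennpowr_ennreal flip: ennreal_mult)
      qed
    qed
  qed
  then show ?thesis by (simp add: I_def G_def S_def r_def)
qed

section \<open>Weights, and the two-weight condition on subsets of cubes\<close>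

lemma weight_measurable:
  fixes u :: "real^'n \<Rightarrow> real"
  assumes "weight u"
  shows "u \<in> borel_measurable lebesgue"
proof -
  have int: "integrable lebesgue (\<lambda>x. indicator (cball 0 (real k)) x *\<^sub>R u x)" for k :: nat
    using assms by (simp add: weight_def set_integrable_def)
  \<comment> \<open>Local integrability makes the truncations to balls measurable; they converge
    pointwise to \<open>u\<close>.\<close>
  have lim: "(\<lambda>k. indicator (cball 0 (real k)) x *\<^sub>R u x) \<longlonglongrightarrow> u x" for x
  proof (rule tendsto_eventually)
    obtain N :: nat where "norm x \<le> real N" using real_arch_simple by blast
    then show "\<forall>\<^sub>F k in sequentially. indicator (cball 0 (real k)) x *\<^sub>R u x = u x"
      by (intro eventually_sequentiallyI[of N]) (auto simp: indicator_def)
  qed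
  show ?thesis
    by (rule borel_measurable_LIMSEQ_real[OF lim borel_measurable_integrable[OF int]])
qed

lemma wmass_cbox_finite:
  assumes "weight u"
  shows "wmass u (cbox a b) < top"
proof -
  have "set_integrable lebesgue (cbox a b) u" and u0: "\<And>x. 0 \<le> u x"
    using assms by (auto simp: weight_def)
  then have "(\<integral>\<^sup>+x. ennreal (norm (indicator (cbox a b) x *\<^sub>R u x)) \<partial>lebesgue) < \<infinity>"
    by (simp add: set_integrable_def integrable_iff_bounded)
  also have "(\<integral>\<^sup>+x. ennreal (norm (indicator (cbox a b) x *\<^sub>R u x)) \<partial>lebesgue) = wmass u (cbox a b)"
    unfolding wmass_def using u0 by (intro nn_integral_cong) (simp add: indicator_def)
  finally show ?thesis by simp
qed

lemma wmass_mono: "A \<subseteq> B \<Longrightarrow> wmass u A \<le> wmass u B"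
  unfolding wmass_def by (intro nn_integral_mono mult_left_mono) (auto simp: indicator_def)

lemma measure_cube:
  fixes a :: "real^'n"
  assumes "0 \<le> l"
  shows "measure lebesgue (cube a l) = l ^ CARD('n)"
  using assms unfolding cube_def by (subst measure_cbox_cart) auto

lemma emeasure_lebesgue_cube:
  fixes a :: "real^'n"
  assumes "0 \<le> l"
  shows "emeasure lebesgue (cube a l) = ennreal (l ^ CARD('n))"
  unfolding measure_cube[OF assms, of a, symmetric] cube_def
  by (rule emeasure_eq_measure2) simp

text \<open>The two-weight condition speaks of cubes, so after Hoelder's inequality on
  \<open>B\<close> both the \<open>u\<close>-mass and the integral of the power of \<open>v\<close>
  are enlarged to the cube. The factor is the \<open>p\<close>-th power of its volume: exponent 1
  from the average of \<open>u\<close> and \<open>p - 1\<close> from the other average.\<close>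

lemma Ap_subset_cube:
  fixes u v g :: "real^'n \<Rightarrow> real"
  assumes p: "1 < p" and A: "Ap_pair p u v" and s: "0 < s" and B: "B \<subseteq> cube a s" "B \<in> sets lebesgue"
    and g: "g \<in> borel_measurable lebesgue" "\<And>x. 0 \<le> g x"
  shows "ennpowr (\<integral>\<^sup>+x\<in>B. ennreal (g x) \<partial>lebesgue) p * wmass u B \<le>
    ennreal ((s ^ CARD('n)) powr p) * Ap_const p u v * (\<integral>\<^sup>+x\<in>B. ennreal (g x powr p * v x) \<partial>lebesgue)"
proof (cases "wmass u B = 0")
  case False
  let ?r = "1 - conj_exp p"
  define R where "R = cube a s"
  define V where "V = s ^ CARD('n)"
  have V: "0 < V" "emeasure lebesgue R = ennreal V"
    using s emeasure_lebesgue_cube[of s a] by (auto simp: V_def R_def)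
  have w: "weight u" "weight v" and Afin: "Ap_const p u v < top"
    using A by (auto simp: Ap_pair_def)
  have v: "v \<in> borel_measurable lebesgue" "\<And>x. 0 \<le> v x"
    using w weight_measurable by (auto simp: weight_def)
  define S where "S = (\<integral>\<^sup>+x\<in>R. ennpowr (ennreal (v x)) ?r \<partial>lebesgue)"
  have "nn_avg R (\<lambda>x. ennreal (u x)) * ennpowr (nn_avg R (\<lambda>x. ennpowr (ennreal (v x)) ?r)) (p - 1)
      \<le> Ap_const p u v"
    unfolding Ap_const_def R_def using s by (intro SUP_upper) (auto simp: cubes_def)
  moreover have "nn_avg R h = ennreal (1 / V) * (\<integral>\<^sup>+x\<in>R. h x \<partial>lebesgue)" for h
    using V by (simp add: nn_avg_def divide_ennreal flip: ennreal_1)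
  ultimately have Ap: "ennreal (1 / V) * wmass u R * ennpowr (ennreal (1 / V) * S) (p - 1) \<le> Ap_const p u v"
    by (simp add: S_def wmass_def)
  \<comment> \<open>A positive \<open>u\<close>-mass is essential here: otherwise the product in the
    two-weight condition could be \<open>0 * top = 0\<close> and would not bound
    \<open>S\<close>.\<close>
  have uR: "wmass u R \<noteq> 0"
    using False wmass_mono[OF B(1), of u] by (auto simp: R_def)
  have S_fin: "S < top"
  proof (rule ccontr)
    assume "\<not> S < top"
    then have "S = top" by (simp add: not_less top_unique)
    then have "ennreal (1 / V) * wmass u R * ennpowr (ennreal (1 / V) * S) (p - 1) = top"
      using V p uR by (simp add: ennreal_mult_top ennreal_mult_eq_top_iff)
    then show False using Ap Afin by (simp add: top_unique)
  qed
  \<comment> \<open>Undoes the normalisation of the average inside the power.\<close>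
  have eqS: "ennpowr S (p - 1) = ennreal (V powr (p - 1)) * ennpowr (ennreal (1 / V) * S) (p - 1)"
    using V p by (simp add: ennpowr_mult ennpowr_ennreal powr_divide flip: mult.assoc ennreal_mult)
  let ?N = "restrict_space lebesgue B"
  have N: "(\<integral>\<^sup>+x. h x \<partial>?N) = (\<integral>\<^sup>+x\<in>B. h x \<partial>lebesgue)" for h
    using B(2) by (subst nn_integral_restrict_space) auto
  have SB: "(\<integral>\<^sup>+x\<in>B. ennpowr (ennreal (v x)) ?r \<partial>lebesgue) \<le> S"
    unfolding S_def R_def using B(1) by (intro nn_integral_mono mult_left_mono) (auto simp: indicator_def)
  have "ennpowr (\<integral>\<^sup>+x\<in>B. ennreal (g x) \<partial>lebesgue) p \<le>
      (\<integral>\<^sup>+x\<in>B. ennreal (g x powr p * v x) \<partial>lebesgue) *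
      ennpowr (\<integral>\<^sup>+x\<in>B. ennpowr (ennreal (v x)) ?r \<partial>lebesgue) (p - 1)"
    unfolding N[symmetric]
  proof (rule Holder_weighted[OF p])
    show "(\<integral>\<^sup>+x. ennpowr (ennreal (v x)) ?r \<partial>?N) < top"
      unfolding N using SB S_fin by (rule le_less_trans)
  qed (use g v in \<open>auto intro: measurable_restrict_space1\<close>)
  also have "\<dots> \<le> (\<integral>\<^sup>+x\<in>B. ennreal (g x powr p * v x) \<partial>lebesgue) * ennpowr S (p - 1)"
    using p SB by (intro mult_left_mono ennpowr_mono) auto
  finally have "ennpowr (\<integral>\<^sup>+x\<in>B. ennreal (g x) \<partial>lebesgue) p * wmass u B \<le>
      (\<integral>\<^sup>+x\<in>B. ennreal (g x powr p * v x) \<partial>lebesgue) * ennpowr S (p - 1) * wmass u R"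
    using wmass_mono[OF B(1), of u] unfolding R_def by (intro mult_mono) auto
  also have "\<dots> = (\<integral>\<^sup>+x\<in>B. ennreal (g x powr p * v x) \<partial>lebesgue) * (ennreal (V powr (p - 1)) *
      (ennreal V * ennreal (1 / V)) * wmass u R * ennpowr (ennreal (1 / V) * S) (p - 1))"
    using V by (subst eqS) (simp add: ac_simps flip: ennreal_mult)
  also have "\<dots> = (\<integral>\<^sup>+x\<in>B. ennreal (g x powr p * v x) \<partial>lebesgue) * ((ennreal (V powr (p - 1)) * ennreal V) *
      (ennreal (1 / V) * wmass u R * ennpowr (ennreal (1 / V) * S) (p - 1)))"
    by (simp only: ac_simps)
  also have "ennreal (V powr (p - 1)) * ennreal V = ennreal (V powr p)"
    using V powr_add[of V "p - 1" 1] by (simp flip: ennreal_mult)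
  also have "(\<integral>\<^sup>+x\<in>B. ennreal (g x powr p * v x) \<partial>lebesgue) * (ennreal (V powr p) *
      (ennreal (1 / V) * wmass u R * ennpowr (ennreal (1 / V) * S) (p - 1))) \<le>
      (\<integral>\<^sup>+x\<in>B. ennreal (g x powr p * v x) \<partial>lebesgue) * (ennreal (V powr p) * Ap_const p u v)"
    by (intro mult_left_mono Ap) auto
  finally show ?thesis by (simp add: V_def ac_simps)
qed simp

section \<open>Iterated bisection\<close>

text \<open>
  This replaces Minkowski's inequality: with \<open>\<theta>\<close> the ratio by which the size of a box shrinks, it
  reproduces the constant in the induction below exactly.
\<close>

lemma powr_add_le_weighted:
  fixes s t \<theta> p :: real
  assumes p: "1 < p" and st: "0 \<le> s" "0 \<le> t" and \<theta>: "0 < \<theta>" "\<theta> < 1"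
  shows "(s + t) powr p \<le> \<theta> powr (1 - p) * s powr p + (1 - \<theta>) powr (1 - p) * t powr p"
proof -
  have ge1: "1 \<le> x powr (1 - p)" if "0 < x" "x < 1" for x :: real
    using that p powr_mono2'[of "1 - p" x 1] by simp
  have scale: "x * (y / x) powr p = x powr (1 - p) * y powr p" if "0 < x" "0 < y" for x y :: real
    using that by (simp add: powr_divide powr_diff field_simps)
  show ?thesis
  proof (cases "s = 0 \<or> t = 0")
    case True
    then show ?thesis
      using p \<theta> ge1[of \<theta>] ge1[of "1 - \<theta>"] mult_right_mono[of 1 _ "s powr p"] mult_right_mono[of 1 _ "t powr p"]
      by auto
  next
    case False
    then have pos: "0 < s" "0 < t" using st by auto
    \<comment> \<open>Convexity of the \<open>p\<close>-th power at \<open>s / \<theta>\<close> and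
      \<open>t / (1 - \<theta>)\<close>, whose mean with weights \<theta> and
      \<open>1 - \<theta>\<close> is \<open>s + t\<close>.\<close>
    have "((1 - (1 - \<theta>)) *\<^sub>R (s / \<theta>) + (1 - \<theta>) *\<^sub>R (t / (1 - \<theta>))) powr p \<le>
        (1 - (1 - \<theta>)) * (s / \<theta>) powr p + (1 - \<theta>) * (t / (1 - \<theta>)) powr p"
      using p \<theta> pos by (intro convex_onD[OF powr_convex]) auto
    then show ?thesis
      using \<theta> pos scale[of \<theta> s] scale[of "1 - \<theta>" t] by simp
  qed
qed

section \<open>Boxes with sides comparable up to a factor 2\<close>

definition fat_box :: "real^'n \<Rightarrow> real^'n \<Rightarrow> bool" where
  "fat_box a b \<longleftrightarrow> (\<forall>j. a $ j < b $ j) \<and> (\<forall>j k. b $ k - a $ k \<le> 2 * (b $ j - a $ j))"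

text \<open>The geometric mean of the side lengths. Unlike the longest side or the diameter, it
  shrinks by exactly the same factor at every bisection, and for a cube it is the side
  length.\<close>

definition box_size :: "real^'n \<Rightarrow> real^'n \<Rightarrow> real" where
  "box_size a b = measure lebesgue (cbox a b) powr (1 / CARD('n))"

lemma longest_side:
  fixes a b :: "real^'n"
  obtains i where "\<And>j. b $ j - a $ j \<le> b $ i - a $ i"
proof -
  let ?S = "range (\<lambda>j. b $ j - a $ j)"
  have "Max ?S \<in> ?S" by (rule Max_in) auto
  then obtain i where "Max ?S = b $ i - a $ i" by (rule rangeE)
  moreover have "b $ j - a $ j \<le> Max ?S" for j by (rule Max_ge) auto
  ultimately have "b $ j - a $ j \<le> b $ i - a $ i" for j by simp
  then show ?thesis by (rule that)
qed

text \<open>Every side \<open>t j\<close> satisfies \<open>t i / 2 \<le> t j \<le> t i\<close> for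
  the longest side \<open>t i\<close>, so the halved side becomes a shortest one and no other side
  exceeds twice its length.\<close>

lemma fat_box_halves:
  fixes a b :: "real^'n"
  assumes fat: "fat_box a b" and i: "\<And>j. b $ j - a $ j \<le> b $ i - a $ i"
  shows "fat_box a (halve i a b b)" "fat_box (halve i a b a) b"
proof -
  have side: "halve i a b b $ j - a $ j = (if j = i then (b $ i - a $ i) / 2 else b $ j - a $ j)"
    "b $ j - halve i a b a $ j = (if j = i then (b $ i - a $ i) / 2 else b $ j - a $ j)" for j
    by (auto simp: halve_nth field_simps)
  define t where "t j = b $ j - a $ j" for j
  have t: "0 < t j" "t k \<le> 2 * t j" "t j \<le> t i" for j k
    using fat i by (auto simp: fat_box_def t_def)
  have pos: "0 < (if j = i then t i / 2 else t j)" for j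
    using t(1) by auto
  have fat': "(if k = i then t i / 2 else t k) \<le> 2 * (if j = i then t i / 2 else t j)" for j k
    using t(1)[of i] t(2)[of i j] t(2)[of k j] t(3)[of k] t(1)[of j]
    by (cases "j = i"; cases "k = i"; simp)
  have "fat_box x y" if "\<And>j. y $ j - x $ j = (if j = i then t i / 2 else t j)" for x y
  proof -
    have "0 < y $ j - x $ j" "y $ k - x $ k \<le> 2 * (y $ j - x $ j)" for j k
      unfolding that by (fact pos fat')+
    then show ?thesis by (simp add: fat_box_def)
  qed
  then show "fat_box a (halve i a b b)" "fat_box (halve i a b a) b"
    using side by (simp_all add: t_def)
qed

lemma fat_box_measure:
  fixes a b :: "real^'n"
  assumes "fat_box a b"
  shows "0 < measure lebesgue (cbox a b)"
    and "((b $ i - a $ i) / 2) ^ CARD('n) \<le> measure lebesgue (cbox a b)"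
    and "(b $ i - a $ i) / 2 \<le> box_size a b"
proof -
  have fat: "a $ j < b $ j" "b $ i - a $ i \<le> 2 * (b $ j - a $ j)" for i j
    using assms unfolding fat_box_def by blast+
  have ab: "a $ j \<le> b $ j" "a $ j < b $ j" "(b $ i - a $ i) / 2 \<le> b $ j - a $ j" for i j
    using fat[of j] fat(2)[of i j] by auto
  show pos: "0 < measure lebesgue (cbox a b)"
    unfolding measure_cbox_cart[OF ab(1)] using ab(2) by (intro prod_pos) auto
  have "(\<Prod>j\<in>(UNIV :: 'n set). (b $ i - a $ i) / 2) \<le> (\<Prod>j\<in>UNIV. b $ j - a $ j)"
    using ab(1,3) by (intro prod_mono) auto
  then show le: "((b $ i - a $ i) / 2) ^ CARD('n) \<le> measure lebesgue (cbox a b)"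
    by (simp add: measure_cbox_cart[OF ab(1)])
  have "(b $ i - a $ i) / 2 = (((b $ i - a $ i) / 2) ^ CARD('n)) powr (1 / CARD('n))"
    using ab(2)[of i] by (simp add: powr_powr flip: powr_realpow)
  also have "\<dots> \<le> box_size a b"
    unfolding box_size_def using le ab(1)[of i] by (intro powr_mono2) auto
  finally show "(b $ i - a $ i) / 2 \<le> box_size a b" .
qed

lemma box_size_halves:
  fixes a b :: "real^'n"
  assumes "fat_box a b"
  shows "box_size a (halve i a b b) = (1 / 2) powr (1 / CARD('n)) * box_size a b"
    and "box_size (halve i a b a) b = (1 / 2) powr (1 / CARD('n)) * box_size a b"
proof -
  have ab: "a $ j \<le> b $ j" for j
    using assms by (auto simp: fat_box_def less_imp_le)
  show "box_size a (halve i a b b) = (1 / 2) powr (1 / CARD('n)) * box_size a b"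
    "box_size (halve i a b a) b = (1 / 2) powr (1 / CARD('n)) * box_size a b"
    using fat_box_measure(1)[OF assms]
    by (simp_all add: box_size_def measure_half[OF ab] powr_divide)
qed

text \<open>A crude bound for the boxes at which the bisection stops: each side is at most twice
  \<open>box_size\<close>, and the norm is at most the sum of the coordinates in absolute
  value.\<close>

lemma lipschitz_diff_average:
  fixes f :: "real^'n \<Rightarrow> real"
  assumes lip: "L-lipschitz_on UNIV f" and fat: "fat_box a b" and x: "x \<in> cbox a b"
  shows "\<bar>f x - avg (cbox a b) f\<bar> \<le> 2 * L * CARD('n) * box_size a b"
proof -
  define V where "V = measure lebesgue (cbox a b)"
  have V: "0 < V" "measure lborel (cbox a b) = V" using fat_box_measure(1)[OF fat] by (auto simp: V_def)
  have L: "0 \<le> L" using lip by (rule lipschitz_on_nonneg)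
  have cont: "continuous_on UNIV f" using lip by (rule lipschitz_on_continuous_on)
  define D where "D = 2 * L * CARD('n) * box_size a b"
  have bound: "norm (f y - f x) \<le> D" if y: "y \<in> cbox a b" for y
  proof -
    have "norm (y - x) \<le> (\<Sum>j\<in>UNIV. \<bar>(y - x) $ j\<bar>)" by (rule norm_le_l1_cart)
    also have "\<dots> \<le> (\<Sum>j\<in>(UNIV :: 'n set). 2 * box_size a b)"
    proof (rule sum_mono)
      fix j
      have "a $ j \<le> x $ j" "x $ j \<le> b $ j" "a $ j \<le> y $ j" "y $ j \<le> b $ j"
        using x y by (auto simp: mem_box_cart)
      then show "\<bar>(y - x) $ j\<bar> \<le> 2 * box_size a b"
        using fat_box_measure(3)[OF fat, of j] by (simp add: abs_if)
    qed
    finally have "L * norm (y - x) \<le> D"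
      using mult_left_mono[OF _ L, of "norm (y - x)" "CARD('n) * (2 * box_size a b)"]
      by (simp add: D_def ac_simps)
    then show ?thesis
      using lipschitz_onD[OF lip, of y x] by (simp add: dist_norm)
  qed
  define I where "I = (LINT y:cbox a b|lebesgue. f y)"
  have "(f has_integral I) (cbox a b)"
    using set_borel_integral_eq_integral[OF set_integrable_cbox_lebesgue(1)[OF cont]]
    by (simp add: I_def set_integrable_cbox_lebesgue(3)[OF cont] integrable_integral)
  then have int: "((\<lambda>y. f y - f x) has_integral (I - V * f x)) (cbox a b)"
    using has_integral_diff[OF _ has_integral_const[of "f x" a b]] V by simp
  have "0 \<le> D" using L by (simp add: D_def box_size_def)
  from has_integral_bound[OF this int bound]
  have "norm (I - V * f x) \<le> D * measure lborel (cbox a b)" .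
  moreover have "f x - avg (cbox a b) f = - (I - V * f x) / V"
    using V by (simp add: avg_def I_def V_def[symmetric] field_simps)
  ultimately show ?thesis
    using V by (simp add: D_def[symmetric] abs_minus_commute divide_le_eq)
qed

section \<open>Oscillation and energy under bisection\<close>

locale two_weight_lipschitz =
  fixes p L :: real and u v f :: "real^'n \<Rightarrow> real" and \<Gamma> :: "real^'n \<Rightarrow> real^'n"
  assumes p: "1 < p" and Ap: "Ap_pair p u v" and lip: "L-lipschitz_on UNIV f"
    and \<Gamma> [measurable]: "\<Gamma> \<in> borel_measurable borel"
    and line: "\<And>x i h. 0 \<le> h \<Longrightarrow>
      ennreal \<bar>f (x + axis i h) - f x\<bar> \<le> (\<integral>\<^sup>+t\<in>{0..h}. ennreal \<bar>\<Gamma> (x + axis i t) $ i\<bar> \<partial>lborel)"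
begin

text \<open>Not divided by the \<open>u\<close>-mass, so that contributions of the two halves can
  simply be added; the normalisation enters once, at the very end.\<close>

definition oscillation :: "real^'n \<Rightarrow> real^'n \<Rightarrow> ennreal" where
  "oscillation a b = (\<integral>\<^sup>+x\<in>cbox a b. ennreal (\<bar>f x - avg (cbox a b) f\<bar> powr p * u x) \<partial>lebesgue)"

definition energy :: "real^'n \<Rightarrow> real^'n \<Rightarrow> ennreal" where
  "energy a b = (\<integral>\<^sup>+x\<in>cbox a b. ennreal (norm (\<Gamma> x) powr p * v x) \<partial>lebesgue)"

lemma weights: "weight u" "weight v" "\<And>x. 0 \<le> u x" "\<And>x. 0 \<le> v x"
  using Ap by (auto simp: Ap_pair_def weight_def)

lemma cbox_meas [measurable]: "cbox c d \<in> sets (lebesgue :: (real^'n) measure)"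
  by simp

lemma meas [measurable]: "u \<in> borel_measurable lebesgue" "v \<in> borel_measurable lebesgue"
    "f \<in> borel_measurable lebesgue" "\<Gamma> \<in> borel_measurable lebesgue"
proof -
  have "f \<in> borel_measurable lborel"
    using borel_measurable_continuous_onI[OF lipschitz_on_continuous_on[OF lip]] by simp
  then show "f \<in> borel_measurable lebesgue" by (rule measurable_completion)
  have "\<Gamma> \<in> borel_measurable lborel" by simp
  then show "\<Gamma> \<in> borel_measurable lebesgue" by (rule measurable_completion)
qed (use weights weight_measurable in blast)+

lemma energy_halves:
  assumes "fat_box a b"
  shows "energy a b = energy a (halve i a b b) + energy (halve i a b a) b"
  unfolding energy_def using assms
  by (intro nn_integral_halves) (auto simp: fat_box_def less_imp_le)

lemma wmass_halves:
  assumes "fat_box a b"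
  shows "wmass u (cbox a b) = wmass u (cbox a (halve i a b b)) + wmass u (cbox (halve i a b a) b)"
  unfolding wmass_def using assms
  by (intro nn_integral_halves) (auto simp: fat_box_def less_imp_le)

text \<open>The \<open>p\<close>-th power of the bound on the jump, combined with the two-weight
  condition on the cube with corner \<open>a\<close> whose side is the longest side of the
  box.\<close>

lemma average_jump:
  assumes fat: "fat_box a b" and i: "\<And>j. b $ j - a $ j \<le> b $ i - a $ i"
    and B': "B' = cbox a (halve i a b b) \<or> B' = cbox (halve i a b a) b"
  shows "ennreal (\<bar>avg B' f - avg (cbox a b) f\<bar> powr p) * wmass u (cbox a b) \<le>
    ennreal ((2 ^ CARD('n) * box_size a b) powr p) * Ap_const p u v * energy a b"
proof -
  define V where "V = measure lebesgue (cbox a b)"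
  define s where "s = b $ i - a $ i"
  define d where "d = box_size a b"
  define \<delta> where "\<delta> = \<bar>avg B' f - avg (cbox a b) f\<bar>"
  define I where "I = (\<integral>\<^sup>+x\<in>cbox a b. ennreal (norm (\<Gamma> x)) \<partial>lebesgue)"
  have ab: "\<And>j. a $ j < b $ j" using fat by (simp add: fat_box_def)
  have V: "0 < V" "(s / 2) ^ CARD('n) \<le> V" "s / 2 \<le> d" "0 < s"
    using fat_box_measure[OF fat] ab[of i] by (auto simp: V_def s_def d_def)
  have sub: "cbox a b \<subseteq> cube a s"
  proof
    fix x assume "x \<in> cbox a b"
    then have "a $ j \<le> x $ j" "x $ j \<le> b $ j" for j by (auto simp: mem_box_cart)
    then show "x \<in> cube a s"
      using i by (auto simp: cube_def mem_box_cart s_def) (metis add.commute diff_le_eq order_trans)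
  qed
  have "ennreal \<delta> \<le> ennreal (s / 2 / V) * I"
    unfolding \<delta>_def s_def V_def I_def nn_integral_completion
    using B' by (intro average_half_diff lipschitz_on_continuous_on[OF lip] \<Gamma> line ab)
  then have "ennpowr (ennreal \<delta>) p \<le> ennpowr (ennreal (s / 2 / V) * I) p"
    using p by (intro ennpowr_mono) auto
  then have "ennreal (\<delta> powr p) \<le> ennreal ((s / 2 / V) powr p) * ennpowr I p"
    using p V by (simp add: ennpowr_mult ennpowr_ennreal \<delta>_def)
  then have "ennreal (\<delta> powr p) * wmass u (cbox a b) \<le> ennreal ((s / 2 / V) powr p) * ennpowr I p * wmass u (cbox a b)"
    by (rule mult_right_mono) simp
  also have "\<dots> \<le> ennreal ((s / 2 / V) powr p) * (ennreal ((s ^ CARD('n)) powr p) * Ap_const p u v * energy a b)"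
    unfolding mult.assoc I_def energy_def
    by (intro mult_left_mono Ap_subset_cube[OF p Ap \<open>0 < s\<close> sub, unfolded mult.assoc]) auto
  also have "\<dots> = ennreal ((s / 2 / V * s ^ CARD('n)) powr p) * Ap_const p u v * energy a b"
  proof -
    have "(s / 2 / V * s ^ CARD('n)) powr p = (s / 2 / V) powr p * (s ^ CARD('n)) powr p"
      by (rule powr_mult)
    then show ?thesis by (simp only: ennreal_mult powr_ge_zero mult.assoc)
  qed
  also have "\<dots> \<le> ennreal ((2 ^ CARD('n) * d) powr p) * Ap_const p u v * energy a b"
  proof (intro mult_right_mono ennreal_leI powr_mono2)
    \<comment> \<open>The volume is at least \<open>(s / 2) ^ CARD('n)\<close> because every side is
      at least \<open>s / 2\<close>; together with \<open>s / 2 \<le> d\<close> this yields the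
      factor \<open>2 ^ CARD('n)\<close>.\<close>
    have "s ^ CARD('n) / V \<le> 2 ^ CARD('n)"
      using V(1,2) by (simp add: power_divide field_simps)
    then have "(s / 2) * (s ^ CARD('n) / V) \<le> d * 2 ^ CARD('n)"
      using V by (intro mult_mono) auto
    then show "s / 2 / V * s ^ CARD('n) \<le> 2 ^ CARD('n) * d" by (simp add: mult.commute)
  qed (use p V in auto)
  finally show ?thesis by (simp add: \<delta>_def d_def)
qed

text \<open>Replaces the mean of a half by another number \<open>m\<close>, in practice the mean of
  its parent box; the jump \<delta> is charged to the \<open>u\<close>-mass of the half.\<close>

lemma oscillation_part:
  assumes \<delta>: "\<bar>avg (cbox c d) f - m\<bar> \<le> \<delta>" and \<theta>: "0 < \<theta>" "\<theta> < 1"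
  shows "(\<integral>\<^sup>+x\<in>cbox c d. ennreal (\<bar>f x - m\<bar> powr p * u x) \<partial>lebesgue) \<le>
    ennreal (\<theta> powr (1 - p)) * oscillation c d +
    ennreal ((1 - \<theta>) powr (1 - p) * \<delta> powr p) * wmass u (cbox c d)"
proof -
  let ?m = "avg (cbox c d) f"
  have \<delta>0: "0 \<le> \<delta>" using \<delta> by linarith
  have "(\<integral>\<^sup>+x\<in>cbox c d. ennreal (\<bar>f x - m\<bar> powr p * u x) \<partial>lebesgue) \<le>
      (\<integral>\<^sup>+x. ennreal (\<theta> powr (1 - p)) * (ennreal (\<bar>f x - ?m\<bar> powr p * u x) * indicator (cbox c d) x) +
        ennreal ((1 - \<theta>) powr (1 - p) * \<delta> powr p) * (ennreal (u x) * indicator (cbox c d) x) \<partial>lebesgue)"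
  proof (rule nn_integral_mono)
    fix x
    have "\<bar>f x - m\<bar> powr p \<le> (\<bar>f x - ?m\<bar> + \<delta>) powr p"
      using p \<delta> by (intro powr_mono2) auto
    also have "\<dots> \<le> \<theta> powr (1 - p) * \<bar>f x - ?m\<bar> powr p + (1 - \<theta>) powr (1 - p) * \<delta> powr p"
      using p \<theta> \<delta>0 by (intro powr_add_le_weighted) auto
    finally have "\<bar>f x - m\<bar> powr p * u x \<le>
        (\<theta> powr (1 - p) * \<bar>f x - ?m\<bar> powr p + (1 - \<theta>) powr (1 - p) * \<delta> powr p) * u x"
      using weights by (intro mult_right_mono) auto
    then have "ennreal (\<bar>f x - m\<bar> powr p * u x) \<le>
        ennreal (\<theta> powr (1 - p) * (\<bar>f x - ?m\<bar> powr p * u x) + (1 - \<theta>) powr (1 - p) * \<delta> powr p * u x)"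
      by (intro ennreal_leI) (simp add: algebra_simps)
    also have "\<dots> = ennreal (\<theta> powr (1 - p)) * ennreal (\<bar>f x - ?m\<bar> powr p * u x) +
        ennreal ((1 - \<theta>) powr (1 - p) * \<delta> powr p) * ennreal (u x)"
      using weights by (simp add: ennreal_plus ennreal_mult)
    finally show "ennreal (\<bar>f x - m\<bar> powr p * u x) * indicator (cbox c d) x \<le>
      ennreal (\<theta> powr (1 - p)) * (ennreal (\<bar>f x - ?m\<bar> powr p * u x) * indicator (cbox c d) x) +
        ennreal ((1 - \<theta>) powr (1 - p) * \<delta> powr p) * (ennreal (u x) * indicator (cbox c d) x)"
      by (simp add: indicator_def)
  qed
  also have "\<dots> = ennreal (\<theta> powr (1 - p)) * oscillation c d +
      ennreal ((1 - \<theta>) powr (1 - p) * \<delta> powr p) * wmass u (cbox c d)"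
    unfolding oscillation_def wmass_def by (simp add: nn_integral_add nn_integral_cmult)
  finally show ?thesis .
qed

text \<open>\<open>k\<close> counts the bisections. The first term reproduces itself at every step,
  while the Lipschitz remainder gains a factor \<theta>.\<close>

lemma oscillation_bound_step:
  fixes \<theta> :: real
  defines "\<theta> \<equiv> (1 / 2) powr (1 / CARD('n))"
  assumes "fat_box a b"
  shows "oscillation a b \<le>
    ennreal ((2 ^ CARD('n) / (1 - \<theta>) * box_size a b) powr p) * Ap_const p u v * energy a b +
    ennreal (\<theta> ^ k * (2 * L * CARD('n) * box_size a b) powr p) * wmass u (cbox a b)"
  using assms(2)
proof (induction k arbitrary: a b)
  case 0
  let ?M = "2 * L * CARD('n) * box_size a b"
  have "oscillation a b \<le> (\<integral>\<^sup>+x. ennreal (?M powr p) * (ennreal (u x) * indicator (cbox a b) x) \<partial>lebesgue)"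
    unfolding oscillation_def
  proof (rule nn_integral_mono)
    fix x
    have "\<bar>f x - avg (cbox a b) f\<bar> powr p * u x \<le> ?M powr p * u x" if "x \<in> cbox a b"
      using p weights lipschitz_diff_average[OF lip 0 that] by (intro mult_right_mono powr_mono2) auto
    then show "ennreal (\<bar>f x - avg (cbox a b) f\<bar> powr p * u x) * indicator (cbox a b) x \<le>
        ennreal (?M powr p) * (ennreal (u x) * indicator (cbox a b) x)"
      using weights by (auto simp: indicator_def ennreal_leI simp flip: ennreal_mult)
  qed
  also have "\<dots> = ennreal (?M powr p) * wmass u (cbox a b)"
    unfolding wmass_def by (simp add: nn_integral_cmult)
  finally show ?case by (simp add: add_increasing)
next
  case (Suc k)
  obtain i where i: "\<And>j. b $ j - a $ j \<le> b $ i - a $ i" using longest_side[of b a] by blast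
  define c where "c = halve i a b b"
  define e where "e = halve i a b a"
  have \<theta>: "0 < \<theta>" "\<theta> < 1" by (simp_all add: \<theta>_def powr01_less_one)
  define D where "D = box_size a b"
  define N :: real where "N = 2 ^ CARD('n)"
  define M where "M = 2 * L * CARD('n) * D"
  define A where "A = N / (1 - \<theta>)"
  have pos: "0 \<le> D" "0 < N" "0 \<le> M" "0 < A"
    using \<theta> lipschitz_on_nonneg[OF lip] by (auto simp: D_def N_def A_def M_def box_size_def)
  define m where "m = avg (cbox a b) f"
  \<comment> \<open>The larger of the two jumps serves both halves with one coefficient, so that
    their masses add up to that of the parent; the jump estimate applies since the maximum is one of
    the two.\<close>
  define \<delta> where "\<delta> = max \<bar>avg (cbox a c) f - m\<bar> \<bar>avg (cbox e b) f - m\<bar>"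
  let ?H = "Ap_const p u v"
  have jump: "ennreal (\<delta> powr p) * wmass u (cbox a b) \<le> ennreal ((N * D) powr p) * ?H * energy a b"
    unfolding \<delta>_def max_def c_def e_def m_def N_def D_def
    using average_jump[OF Suc.prems i] by simp
  have "oscillation a b = (\<integral>\<^sup>+x\<in>cbox a c. ennreal (\<bar>f x - m\<bar> powr p * u x) \<partial>lebesgue) +
      (\<integral>\<^sup>+x\<in>cbox e b. ennreal (\<bar>f x - m\<bar> powr p * u x) \<partial>lebesgue)"
    unfolding oscillation_def m_def c_def e_def using Suc.prems
    by (intro nn_integral_halves) (auto simp: fat_box_def less_imp_le)
  also have "\<dots> \<le> (ennreal (\<theta> powr (1 - p)) * oscillation a c +
        ennreal ((1 - \<theta>) powr (1 - p) * \<delta> powr p) * wmass u (cbox a c)) +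
      (ennreal (\<theta> powr (1 - p)) * oscillation e b +
        ennreal ((1 - \<theta>) powr (1 - p) * \<delta> powr p) * wmass u (cbox e b))"
    by (intro add_mono oscillation_part \<theta>) (auto simp: \<delta>_def)
  also have "\<dots> = ennreal (\<theta> powr (1 - p)) * (oscillation a c + oscillation e b) +
      ennreal ((1 - \<theta>) powr (1 - p) * \<delta> powr p) * wmass u (cbox a b)"
    unfolding wmass_halves[OF Suc.prems, of i] c_def e_def
    by (simp add: distrib_left ac_simps)
  also have "\<dots> = ennreal (\<theta> powr (1 - p)) * (oscillation a c + oscillation e b) +
      ennreal ((1 - \<theta>) powr (1 - p)) * (ennreal (\<delta> powr p) * wmass u (cbox a b))"
    by (simp add: ennreal_mult mult.assoc)
  also have "\<dots> \<le> ennreal (\<theta> powr (1 - p)) *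
      ((ennreal ((A * (\<theta> * D)) powr p) * ?H * energy a c +
        ennreal (\<theta> ^ k * (\<theta> * M) powr p) * wmass u (cbox a c)) +
       (ennreal ((A * (\<theta> * D)) powr p) * ?H * energy e b +
        ennreal (\<theta> ^ k * (\<theta> * M) powr p) * wmass u (cbox e b))) +
      ennreal ((1 - \<theta>) powr (1 - p)) * (ennreal ((N * D) powr p) * ?H * energy a b)"
  proof (intro add_mono mult_left_mono jump)
    have "fat_box a c" "fat_box e b" "box_size a c = \<theta> * D" "box_size e b = \<theta> * D"
      using fat_box_halves[OF Suc.prems i] box_size_halves[OF Suc.prems, of i]
      by (auto simp: c_def e_def D_def \<theta>_def)
    then show "oscillation a c \<le> ennreal ((A * (\<theta> * D)) powr p) * ?H * energy a c +
        ennreal (\<theta> ^ k * (\<theta> * M) powr p) * wmass u (cbox a c)"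
      "oscillation e b \<le> ennreal ((A * (\<theta> * D)) powr p) * ?H * energy e b +
        ennreal (\<theta> ^ k * (\<theta> * M) powr p) * wmass u (cbox e b)"
      using Suc.IH[of a c] Suc.IH[of e b] by (simp_all add: A_def N_def M_def ac_simps)
  qed auto
  also have "\<dots> = ennreal (\<theta> powr (1 - p)) * (ennreal ((A * (\<theta> * D)) powr p) * (?H * energy a b) +
        ennreal (\<theta> ^ k * (\<theta> * M) powr p) * wmass u (cbox a b)) +
      ennreal ((1 - \<theta>) powr (1 - p)) * (ennreal ((N * D) powr p) * (?H * energy a b))"
    unfolding wmass_halves[OF Suc.prems, of i] energy_halves[OF Suc.prems, of i] c_def e_def
    by (simp add: distrib_left ac_simps)
  also have "\<dots> = (ennreal (\<theta> powr (1 - p) * (A * (\<theta> * D)) powr p) +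
        ennreal ((1 - \<theta>) powr (1 - p) * (N * D) powr p)) * (?H * energy a b) +
      ennreal (\<theta> powr (1 - p) * (\<theta> ^ k * (\<theta> * M) powr p)) * wmass u (cbox a b)"
    using \<theta> by (simp add: ennreal_mult distrib_left distrib_right ac_simps)
  also have "ennreal (\<theta> powr (1 - p) * (A * (\<theta> * D)) powr p) +
        ennreal ((1 - \<theta>) powr (1 - p) * (N * D) powr p) = ennreal ((A * D) powr p)"
  proof -
    have 1: "\<theta> powr (1 - p) * (A * (\<theta> * D)) powr p = \<theta> * (A * D) powr p"
      using \<theta> pos by (simp add: powr_mult powr_diff)
    \<comment> \<open>Origin of \<open>A\<close>: it solves \<open>N = (1 - \<theta>) * A\<close>,
      so the contributions of the halves and of the jump are the shares \<theta> and
      \<open>1 - \<theta>\<close> of the same power.\<close>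
    have ND: "N * D = (1 - \<theta>) * (A * D)" using \<theta> by (simp add: A_def)
    have 2: "(1 - \<theta>) powr (1 - p) * (N * D) powr p = (1 - \<theta>) * (A * D) powr p"
      unfolding ND using \<theta> pos by (simp add: powr_mult powr_diff)
    have nonneg: "0 \<le> \<theta> * (A * D) powr p" "0 \<le> (1 - \<theta>) * (A * D) powr p"
      using \<theta> by simp_all
    have "\<theta> * (A * D) powr p + (1 - \<theta>) * (A * D) powr p = (A * D) powr p"
      by (simp add: left_diff_distrib)
    then show ?thesis unfolding 1 2 ennreal_plus[OF nonneg, symmetric] by simp
  qed
  \<comment> \<open>The smaller size gives \<theta> to the power \<open>p\<close>, the convexity
    coefficient \<theta> to the power \<open>1 - p\<close>: a net gain of one factor
    \<theta>.\<close>
  also have "\<theta> powr (1 - p) * (\<theta> ^ k * (\<theta> * M) powr p) = \<theta> ^ Suc k * M powr p"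
    using \<theta> pos by (simp add: powr_mult powr_diff)
  finally show ?case
    by (simp add: A_def N_def D_def M_def mult.assoc)
qed

text \<open>Let the number of bisections tend to infinity: the box has finite \<open>u\<close>-mass
  and \<theta> is below 1, so the remainder vanishes.\<close>

lemma oscillation_bound:
  assumes fat: "fat_box a b"
  shows "oscillation a b \<le>
    ennreal ((2 ^ CARD('n) / (1 - (1 / 2) powr (1 / CARD('n))) * box_size a b) powr p) * Ap_const p u v * energy a b"
    (is "_ \<le> ?Y")
proof -
  define \<theta> :: real where "\<theta> = (1 / 2) powr (1 / CARD('n))"
  have \<theta>: "0 \<le> \<theta>" "\<theta> < 1" by (simp_all add: \<theta>_def powr01_less_one)
  define C where "C = (2 * L * CARD('n) * box_size a b) powr p"
  obtain w where w: "wmass u (cbox a b) = ennreal w" "0 \<le> w"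
    using wmass_cbox_finite[OF weights(1), of a b] by (cases "wmass u (cbox a b)") auto
  have step: "oscillation a b \<le> ?Y + ennreal (\<theta> ^ k * C * w)" for k
    using oscillation_bound_step[OF fat, of k] w \<theta>
    by (simp add: \<theta>_def C_def ennreal_mult)
  have "(\<lambda>k. \<theta> ^ k * C * w) \<longlonglongrightarrow> 0 * C * w"
    by (intro tendsto_intros LIMSEQ_power_zero) (use \<theta> in simp)
  then have "(\<lambda>k. ?Y + ennreal (\<theta> ^ k * C * w)) \<longlonglongrightarrow> ?Y + ennreal 0"
    by (intro tendsto_add tendsto_const tendsto_ennrealI) simp
  then show ?thesis
    using step by (intro LIMSEQ_le_const) auto
qed

end

theorem corollary1p8:
  shows "\<exists>c::real. c > 0 \<and>
    (\<forall>(p::real) (u :: real^'n \<Rightarrow> real) (v :: real^'n \<Rightarrow> real).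
       1 < p \<longrightarrow> Ap_pair p u v \<longrightarrow> Ainf_weight u \<longrightarrow>
       (\<forall>(f :: real^'n \<Rightarrow> real) a l. (\<exists>L. L-lipschitz_on UNIV f) \<longrightarrow> 0 < l \<longrightarrow>
          (let Q = cube a l in
             ennpowr (1 / wmass u Q *
               (\<integral>\<^sup>+x\<in>Q. ennreal (\<bar>f x - avg Q f\<bar> powr p * u x) \<partial>lebesgue)) (1 / p)
             \<le> ennreal c * ennpowr (Ap_const p u v) (1 / p) * ennreal l *
               ennpowr (1 / wmass u Q *
                 (\<integral>\<^sup>+x\<in>Q. ennreal (norm (grad f x) powr p * v x) \<partial>lebesgue)) (1 / p))))"
proof -
  define c where "c = 2 ^ CARD('n) / (1 - (1 / 2) powr (1 / CARD('n)) :: real)"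
  have c: "c > 0" by (simp add: c_def powr01_less_one)
  show ?thesis
  proof (intro exI[of _ c] conjI c allI impI)
    fix p :: real and u v f :: "real^'n \<Rightarrow> real" and a :: "real^'n" and l :: real
    assume p: "1 < p" and Ap: "Ap_pair p u v" and "\<exists>L. L-lipschitz_on UNIV f" and l: "0 < l"
    then obtain L where lip: "L-lipschitz_on UNIV f" by blast
    obtain \<Gamma> :: "real^'n \<Rightarrow> real^'n" where \<Gamma>: "\<Gamma> \<in> borel_measurable borel"
      and grad: "AE x in lborel. grad f x = \<Gamma> x"
      and line: "\<And>x i h. 0 \<le> h \<Longrightarrow>
        ennreal \<bar>f (x + axis i h) - f x\<bar> \<le> (\<integral>\<^sup>+t\<in>{0..h}. ennreal \<bar>\<Gamma> (x + axis i t) $ i\<bar> \<partial>lborel)"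
      using lipschitz_gradient[OF lip] by blast
    interpret two_weight_lipschitz p L u v f \<Gamma>
      by unfold_locales (fact p Ap lip \<Gamma> line)+
    define b :: "real^'n" where "b = (\<chi> i. a $ i + l)"
    define Q where "Q = cube a l"
    have Q: "Q = cbox a b" by (simp add: Q_def cube_def b_def)
    have fat: "fat_box a b" using l by (simp add: fat_box_def b_def)
    have size: "box_size a b = l"
      using measure_cube[of l a] l unfolding box_size_def Q[symmetric] Q_def
      by (simp add: powr_powr flip: powr_realpow)
    have energy: "energy a b = (\<integral>\<^sup>+x\<in>Q. ennreal (norm (grad f x) powr p * v x) \<partial>lebesgue)"
      unfolding energy_def Q
      by (rule nn_integral_cong_AE, use AE_completion[OF grad] in eventually_elim) simp
    \<comment> \<open>When \<open>u\<close> has no mass on \<open>Q\<close> this factor is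
      \<open>top\<close>; the argument multiplies by it and uses monotonicity only, so that case
      needs no separate treatment.\<close>
    let ?w = "1 / wmass u Q"
    have "?w * oscillation a b \<le> ?w * (ennreal ((c * l) powr p) * Ap_const p u v * energy a b)"
      using oscillation_bound[OF fat] by (intro mult_left_mono) (simp_all add: c_def size)
    then have "ennpowr (?w * oscillation a b) (1 / p) \<le>
        ennpowr (ennreal ((c * l) powr p) * Ap_const p u v * (?w * energy a b)) (1 / p)"
      using p by (intro ennpowr_mono) (simp_all add: ac_simps)
    also have "\<dots> = ennreal (c * l) * ennpowr (Ap_const p u v) (1 / p) * ennpowr (?w * energy a b) (1 / p)"
      using p c l by (simp add: ennpowr_mult[of "1 / p"] ennpowr_ennreal powr_powr)
    also have "\<dots> = ennreal c * ennpowr (Ap_const p u v) (1 / p) * ennreal l * ennpowr (?w * energy a b) (1 / p)"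
      using c l by (simp add: ennreal_mult ac_simps)
    finally show "let Q = cube a l in
       ennpowr (1 / wmass u Q * (\<integral>\<^sup>+x\<in>Q. ennreal (\<bar>f x - avg Q f\<bar> powr p * u x) \<partial>lebesgue)) (1 / p)
       \<le> ennreal c * ennpowr (Ap_const p u v) (1 / p) * ennreal l *
         ennpowr (1 / wmass u Q * (\<integral>\<^sup>+x\<in>Q. ennreal (norm (grad f x) powr p * v x) \<partial>lebesgue)) (1 / p)"
      unfolding Let_def energy oscillation_def Q Q_def[symmetric] .
  qed
qed

end
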